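(* There is a constant $c>0$ such that, for all sufficiently large $N$, each of the four quantities $\mathfrak{S}_{\mathbb{T}^2}(N)$, $\mathfrak{M}_{\mathbb{T}^2}(N)$, $\mathfrak{S}_{\mathbb{R}^2}(N)$, $\mathfrak{M}_{\mathbb{R}^2}(N)$ is at least \[ (\log N)^{c/\log\log\log N}. \]
   Context: A weight is a nonnegative locally integrable function; X-ray transforms below take values in $[0,\infty]$, and $0\cdot\infty=0$. "Least constant" means the infimum of admissible constants in $[0,\infty]$. The definitions are used with $d=2$. Euclidean setting. For $u_0\in \mathrm{L}^2(\mathbb{R}^d)$ with compactly supported Fourier transform put \[ u(x,t)=\int_{\mathbb{R}^d}\widehat{u_0}(\xi) e^{2\pi i(x\cdot \xi+t|\xi|^2)}\,\mathrm{d}\xi,\quad (x,t)\in\mathbb{R}^d\times\mathbb{R}, \] and for a weight $w$ on $\mathbb{R}^d\times\mathbb{R}$ put $\rho^{\ast}w(x,v)=\int_{\mathbb{R}}w(x-2tv,t)\,\mathrm{d}t$ for $x,v\in\mathbb{R}^d$. For $N\ge1$, $\mathfrak{S}_{\mathbb{R}^d}(N)$ is the least constant $C$ such that \[ \int_0^1\int_{\mathbb{R}^d}|u(x,t)|^2w(x,t)\,\mathrm{d}x\,\mathrm{d}t \le C\int_{\mathbb{R}^d}|\widehat{u_0}(v)|^2\sup_{x\in\mathbb{R}^d}\rho^{\ast}w(x,v)\,\mathrm{d}v, \] and $\mathfrak{M}_{\mathbb{R}^d}(N)$ is the least constant $C$ such that \[ \int_0^1\int_{\mathbb{R}^d}|u(x,t)|^2w(x,t)\,\mathrm{d}x\,\mathrm{d}t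 \le C\sup_{x\in\mathbb{R}^d,\ v\in\operatorname{supp}\widehat{u_0}}\rho^{\ast}w(x,v)\ \|u_0\|_{\mathrm{L}^2(\mathbb{R}^d)}^2, \] in each case for all weights $w$ on $\mathbb{R}^d\times\mathbb{R}$ and all $u_0\in\mathrm{L}^2(\mathbb{R}^d)$ with $\operatorname{supp}\widehat{u_0}\subseteq[-N,N]^d$. Periodic setting. Let $\mathbb{T}^d=\mathbb{R}^d/\mathbb{Z}^d$. For a trigonometric polynomial $u_0$ on $\mathbb{T}^d$ put \[ u(x,t)=\sum_{k\in\mathbb{Z}^d}\widehat{u_0}(k)e^{2\pi i(x\cdot k+t|k|^2)},\quad (x,t)\in\mathbb{T}^d\times\mathbb{T}, \] and for a weight $w$ on $\mathbb{T}^d\times\mathbb{T}$ put $\rho^{\ast}_{\mathbb{Z}^d}w(x,k)=\int_0^1 w(x-2tk,t)\,\mathrm{d}t$ for $(x,k)\in\mathbb{T}^d\times\mathbb{Z}^d$. For $N\ge1$, $\mathfrak{S}_{\mathbb{T}^d}(N)$ is the least constant $C$ such that \[ \int_{\mathbb{T}} \int_{\mathbb{T}^d} |u(x,t)|^2w(x,t)\,\mathrm{d}x\,\mathrm{d}t\leq C\sum_{k\in\mathbb{Z}^d}|\widehat{u_0}(k)|^2\sup_{x\in\mathbb{T}^d}\rho^{\ast}_{\mathbb{Z}^{d}}w(x,k), \] and $\mathfrak{M}_{\mathbb{T}^d}(N)$ is the least constant $C$ such that \[ \int_{\mathbb{T}} \int_{\mathbb{T}^d} |u(x,t)|^2w(x,t)\,\mathrm{d}x\,\mathrm{d}t\leq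 C \sup_{x\in\mathbb{T}^d,\ k\in\operatorname{supp}\widehat{u_0}}\rho^{\ast}_{\mathbb{Z}^{d}}w(x,k) \,\|u_0\|_{\mathrm{L}^2(\mathbb{T}^d)}^2, \] in each case for all weights $w$ on $\mathbb{T}^d\times\mathbb{T}$ and all trigonometric polynomials $u_0$ with $\operatorname{supp}\widehat{u_0}\subseteq\mathbb{Z}^d\cap[-N,N]^d$. *)

theory Defs
  imports "HOL-Analysis.Analysis"
begin

text \<open>
  Functions on \<open>\<real>\<^sup>d\<close> are functions on \<open>real ^ 'd\<close>, and functions on the tori are
  \<open>1\<close>-periodic functions, integrated over the unit cube. All functions are Borel measurable
  representatives. Quantities in \<open>[0,\<infinity>]\<close> live in \<open>ennreal\<close>, where \<open>0 * \<infinity> = 0\<close> and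
  \<open>Inf {} = \<infinity>\<close>. The dimension enters the constants below through a type argument.
\<close>

text \<open>The X-ray transforms need \<open>w\<close> on every line, so a weight is a genuine Borel function and not
  an equivalence class modulo null sets.\<close>

definition weight :: "((real ^ 'd) \<times> real \<Rightarrow> real) \<Rightarrow> bool" where
  "weight w \<longleftrightarrow> w \<in> borel_measurable borel \<and> (\<forall>z. 0 \<le> w z) \<and>
     (\<forall>K. compact K \<longrightarrow> set_integrable lborel K w)"

definition L2_norm_sq :: "(real ^ 'd) set \<Rightarrow> (real ^ 'd \<Rightarrow> complex) \<Rightarrow> ennreal" where
  "L2_norm_sq A f = (\<integral>\<^sup>+x\<in>A. ennreal ((norm (f x))\<^sup>2) \<partial>lborel)"


subsection \<open>Euclidean setting\<close>

definition in_L2 :: "(real ^ 'd \<Rightarrow> complex) \<Rightarrow> bool" where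
  "in_L2 f \<longleftrightarrow> f \<in> borel_measurable borel \<and> L2_norm_sq UNIV f < \<infinity>"

definition fourier_integral :: "(real ^ 'd \<Rightarrow> complex) \<Rightarrow> real ^ 'd \<Rightarrow> complex" where
  "fourier_integral f \<xi> = (LINT x|lborel. f x * cis (- 2 * pi * (x \<bullet> \<xi>)))"

text \<open>The Fourier transform on \<open>L\<^sup>2\<close> is the continuous extension of the Fourier integral from
  \<open>L\<^sup>1 \<inter> L\<^sup>2\<close>; \<open>g\<close> is any representative of it.\<close>

definition fourier_L2 :: "(real ^ 'd \<Rightarrow> complex) \<Rightarrow> (real ^ 'd \<Rightarrow> complex) \<Rightarrow> bool" where
  "fourier_L2 f g \<longleftrightarrow> in_L2 f \<and> in_L2 g \<and>
     (\<exists>F. (\<forall>n::nat. integrable lborel (F n) \<and> in_L2 (F n)) \<and>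
          (\<lambda>n. L2_norm_sq UNIV (\<lambda>x. F n x - f x)) \<longlonglongrightarrow> 0 \<and>
          (\<lambda>n. L2_norm_sq UNIV (\<lambda>\<xi>. fourier_integral (F n) \<xi> - g \<xi>)) \<longlonglongrightarrow> 0)"

text \<open>The support of an \<open>L\<^sup>2\<close> function: complement of the largest open set on which it vanishes
  almost everywhere.\<close>

definition ess_support :: "(real ^ 'd \<Rightarrow> complex) \<Rightarrow> (real ^ 'd) set" where
  "ess_support g = {v. \<forall>U. open U \<longrightarrow> v \<in> U \<longrightarrow> \<not> (AE x in lborel. x \<in> U \<longrightarrow> g x = 0)}"

text \<open>Here \<open>g\<close> stands for the Fourier transform of the initial datum.\<close>

definition schroedinger_R :: "(real ^ 'd \<Rightarrow> complex) \<Rightarrow> real ^ 'd \<Rightarrow> real \<Rightarrow> complex" where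
  "schroedinger_R g x t = (LINT \<xi>|lborel. g \<xi> * cis (2 * pi * (x \<bullet> \<xi> + t * (norm \<xi>)\<^sup>2)))"

definition xray_R :: "((real ^ 'd) \<times> real \<Rightarrow> real) \<Rightarrow> real ^ 'd \<Rightarrow> real ^ 'd \<Rightarrow> ennreal" where
  "xray_R w x v = (\<integral>\<^sup>+t. ennreal (w (x - (2 * t) *\<^sub>R v, t)) \<partial>lborel)"

definition energy_R :: "(real ^ 'd \<Rightarrow> complex) \<Rightarrow> ((real ^ 'd) \<times> real \<Rightarrow> real) \<Rightarrow> ennreal" where
  "energy_R g w =
     (\<integral>\<^sup>+t\<in>{0..1}. (\<integral>\<^sup>+x. ennreal ((norm (schroedinger_R g x t))\<^sup>2 * w (x, t)) \<partial>lborel) \<partial>lborel)"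

definition box_R :: "real \<Rightarrow> (real ^ 'd) set" where
  "box_R N = {v. \<forall>i. - N \<le> v $ i \<and> v $ i \<le> N}"

text \<open>The supremum over \<open>x\<close> of the X-ray transform is a supremum of uncountably many Borel
  functions of \<open>v\<close>, hence only Lebesgue measurable in general; the nonnegative integral over
  \<open>lborel\<close> (a supremum over Borel simple minorants) still gives its Lebesgue integral.\<close>

definition S_R :: "'d::finite itself \<Rightarrow> real \<Rightarrow> ennreal" where
  "S_R _ N = Inf {C. \<forall>(w :: (real ^ 'd) \<times> real \<Rightarrow> real) u0 g.
     weight w \<longrightarrow> fourier_L2 u0 g \<longrightarrow> ess_support g \<subseteq> box_R N \<longrightarrow>
       energy_R g w \<le> C * (\<integral>\<^sup>+v. ennreal ((norm (g v))\<^sup>2) * (SUP x. xray_R w x v) \<partial>lborel)}"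

definition M_R :: "'d::finite itself \<Rightarrow> real \<Rightarrow> ennreal" where
  "M_R _ N = Inf {C. \<forall>(w :: (real ^ 'd) \<times> real \<Rightarrow> real) u0 g.
     weight w \<longrightarrow> fourier_L2 u0 g \<longrightarrow> ess_support g \<subseteq> box_R N \<longrightarrow>
       energy_R g w \<le>
         C * (SUP (x, v) \<in> UNIV \<times> ess_support g. xray_R w x v) * L2_norm_sq UNIV u0}"


subsection \<open>Periodic setting\<close>

definition of_int_vec :: "int ^ 'd \<Rightarrow> real ^ 'd" where
  "of_int_vec k = (\<chi> i. of_int (k $ i))"

definition unit_cube :: "(real ^ 'd) set" where
  "unit_cube = {x. \<forall>i. 0 \<le> x $ i \<and> x $ i \<le> 1}"

definition periodic_weight :: "((real ^ 'd) \<times> real \<Rightarrow> real) \<Rightarrow> bool" where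
  "periodic_weight w \<longleftrightarrow> weight w \<and>
     (\<forall>x t (k :: int ^ 'd) (m :: int). w (x + of_int_vec k, t + of_int m) = w (x, t))"

definition trig_polynomial :: "(real ^ 'd \<Rightarrow> complex) \<Rightarrow> bool" where
  "trig_polynomial f \<longleftrightarrow> (\<exists>(K :: (int ^ 'd) set) a. finite K \<and>
     f = (\<lambda>x. \<Sum>k\<in>K. a k * cis (2 * pi * (x \<bullet> of_int_vec k))))"

definition fourier_coeff :: "(real ^ 'd \<Rightarrow> complex) \<Rightarrow> int ^ 'd \<Rightarrow> complex" where
  "fourier_coeff f k = (LINT x:unit_cube|lborel. f x * cis (- 2 * pi * (x \<bullet> of_int_vec k)))"

definition fourier_support :: "(real ^ 'd \<Rightarrow> complex) \<Rightarrow> (int ^ 'd) set" where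
  "fourier_support f = {k. fourier_coeff f k \<noteq> 0}"

definition schroedinger_T :: "(real ^ 'd \<Rightarrow> complex) \<Rightarrow> real ^ 'd \<Rightarrow> real \<Rightarrow> complex" where
  "schroedinger_T u0 x t = (\<Sum>\<^sub>\<infinity>k. fourier_coeff u0 k *
     cis (2 * pi * (x \<bullet> of_int_vec k + t * (norm (of_int_vec k))\<^sup>2)))"

definition xray_T :: "((real ^ 'd) \<times> real \<Rightarrow> real) \<Rightarrow> real ^ 'd \<Rightarrow> int ^ 'd \<Rightarrow> ennreal" where
  "xray_T w x k = (\<integral>\<^sup>+t\<in>{0..1}. ennreal (w (x - (2 * t) *\<^sub>R of_int_vec k, t)) \<partial>lborel)"

definition energy_T :: "(real ^ 'd \<Rightarrow> complex) \<Rightarrow> ((real ^ 'd) \<times> real \<Rightarrow> real) \<Rightarrow> ennreal" where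
  "energy_T u0 w =
     (\<integral>\<^sup>+t\<in>{0..1}. (\<integral>\<^sup>+x\<in>unit_cube. ennreal ((norm (schroedinger_T u0 x t))\<^sup>2 * w (x, t))
        \<partial>lborel) \<partial>lborel)"

definition box_T :: "real \<Rightarrow> (int ^ 'd) set" where
  "box_T N = {k. of_int_vec k \<in> box_R N}"

definition S_T :: "'d::finite itself \<Rightarrow> real \<Rightarrow> ennreal" where
  "S_T _ N = Inf {C. \<forall>(w :: (real ^ 'd) \<times> real \<Rightarrow> real) u0.
     periodic_weight w \<longrightarrow> trig_polynomial u0 \<longrightarrow> fourier_support u0 \<subseteq> box_T N \<longrightarrow>
       energy_T u0 w \<le>
         C * (\<Sum>\<^sub>\<infinity>k. ennreal ((norm (fourier_coeff u0 k))\<^sup>2) * (SUP x. xray_T w x k))}"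

definition M_T :: "'d::finite itself \<Rightarrow> real \<Rightarrow> ennreal" where
  "M_T _ N = Inf {C. \<forall>(w :: (real ^ 'd) \<times> real \<Rightarrow> real) u0.
     periodic_weight w \<longrightarrow> trig_polynomial u0 \<longrightarrow> fourier_support u0 \<subseteq> box_T N \<longrightarrow>
       energy_T u0 w \<le>
         C * (SUP (x, k) \<in> UNIV \<times> fourier_support u0. xray_T w x k) * L2_norm_sq unit_cube u0}"

end

theory Submission
  imports Defs "HOL-Probability.Sinc_Integral"
begin

text \<open>
  For large \<open>N\<close> the four constants are in fact at least a multiple of \<open>ln N\<close>, which exceeds
  \<open>ln N powr (1 / ln (ln (ln N)))\<close>. The examples depend on one space variable only.
  Take \<open>n\<close> of order \<open>ln N\<close>, the lacunary frequencies \<open>(8 ^ i, 0)\<close> with \<open>i < n\<close>, the datum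
  \<open>u0 = \<Sum>i<n. cis (2 * pi * 8 ^ i * x $ 1)\<close> with solution \<open>u\<close>, and as weight the Riesz product
  \<open>w = \<Prod>i<n. 1 + cos (2 * pi * (8 ^ i * x $ 1 + 64 ^ i * t))\<close>,
  whose factors oscillate at the same space-time frequencies on the paraboloid as the waves in \<open>u\<close>.

  The X-ray transform of \<open>w\<close> in the direction \<open>(8 ^ j, 0)\<close> is the mean over \<open>t\<close> of a Riesz product with
  frequencies \<open>64 ^ i - 2 * 8 ^ (i + j)\<close>. These are lacunary for each fixed \<open>j\<close> (\<open>lacunary_parabola\<close>), so
  all the relevant X-ray transforms are equal to \<open>1\<close> (\<open>riesz_xray\<close>): no line of an admissible direction
  sees any concentration of \<open>w\<close>. On the other hand \<open>w\<close> is strongly correlated with \<open>u\<close>: each of the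
  \<open>n\<close> waves in \<open>u\<close> has integral \<open>1 / 2\<close> against \<open>w\<close> (\<open>riesz_coefficient\<close>). Integrating
  \<open>\<bar>u\<bar>\<^sup>2 \<ge> n * Re u - n\<^sup>2 / 4\<close> against \<open>w\<close> gives an energy of at least \<open>n\<^sup>2 / 4\<close>, while
  the squared norm of \<open>u0\<close> is \<open>n\<close>; this is a loss of \<open>n / 4\<close> on the torus (\<open>torus_constants_ge\<close>).

  In Euclidean space each frequency is thickened to a bump of tiny width \<open>\<delta>\<close>, and \<open>w\<close> is restricted
  to \<open>0 \<le> t \<le> 1\<close>. The X-ray transform changes by at most \<open>1\<close> over a bump, because \<open>w\<close> is Lipschitz
  (\<open>xray_strip_le\<close>), and \<open>u\<close> stays close to a multiple of the periodic solution on a square whose side is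
  comparable to \<open>1 / \<delta>\<close> (\<open>schroedinger_datum_ge\<close>), which carries a fixed proportion of the mass
  of the datum. So the loss is again a multiple of \<open>n\<close> (\<open>euclidean_constants_ge\<close>). The bumps are
  triangle functions, which makes the datum a modulated Fejer kernel; its Fourier transform follows
  from a scaling argument (\<open>fejer_fourier\<close>), and its norm is bounded by averaging over translates
  (\<open>weighted_line_sum\<close>).
\<close>

section \<open>Riesz products\<close>

lemma has_integral_cos_int_freq:
  fixes k :: int and \<phi> :: real and L :: nat
  assumes "k \<noteq> 0"
  shows "((\<lambda>t. cos (2 * pi * of_int k * t + \<phi>)) has_integral 0) {0..real L}"
proof -
  have "((\<lambda>t. cos (2 * pi * of_int k * t + \<phi>)) has_integral
      (sin (2 * pi * of_int k * real L + \<phi>) / (2 * pi * of_int k)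
       - sin (2 * pi * of_int k * 0 + \<phi>) / (2 * pi * of_int k))) {0..real L}"
    using assms
    by (intro fundamental_theorem_of_calculus)
       (auto intro!: derivative_eq_intros simp flip: has_real_derivative_iff_has_vector_derivative)
  moreover have "sin (2 * pi * of_int k * real L + \<phi>) = sin \<phi>"
  proof -
    have "sin (2 * pi * of_int k * real L + \<phi>) = sin (\<phi> + 2 * pi * of_int (k * int L))"
      by (simp add: algebra_simps)
    also have "\<dots> = sin \<phi>"
      using sin_add[of \<phi> "2 * pi * of_int (k * int L)"] sin_int_2pin cos_int_2pin by (metis add.right_neutral mult_zero_right mult.right_neutral)
    finally show ?thesis .
  qed
  ultimately show ?thesis by simp
qed

text \<open>
  With lacunary linear phases \<open>\<alpha> i\<close> this is the density of a classical Riesz product; all phases are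
  kept as data, because the same product is integrated below along several different lines.
\<close>

definition riesz :: "nat \<Rightarrow> (nat \<Rightarrow> real) \<Rightarrow> real" where
  "riesz n \<alpha> = (\<Prod>i<n. 1 + cos (\<alpha> i))"

lemma riesz_Suc: "riesz (Suc n) \<alpha> = riesz n \<alpha> * (1 + cos (\<alpha> n))"
  by (simp add: riesz_def)

lemma riesz_nonneg: "0 \<le> riesz n \<alpha>"
  unfolding riesz_def
proof (intro prod_nonneg)
  show "0 \<le> 1 + cos (\<alpha> i)" for i
    using cos_ge_minus_one[of "\<alpha> i"] by linarith
qed

text \<open>
  The partial product with \<open>n\<close> factors has all its frequencies in \<open>[-S, S]\<close>, where
  \<open>S = \<Sum>i<n. \<bar>m i\<bar>\<close>, so it is orthogonal to any frequency beyond \<open>S\<close>. Means and coefficients of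
  Riesz products are computed by splitting off the last factor and applying this.
\<close>

lemma riesz_high_frequency:
  fixes m :: "nat \<Rightarrow> int"
  assumes "(\<Sum>i<n. \<bar>m i\<bar>) < \<bar>k\<bar>"
  shows "((\<lambda>t. cos (2 * pi * of_int k * t + \<phi>) * riesz n (\<lambda>i. 2 * pi * of_int (m i) * t + \<theta> i))
           has_integral 0) {0..real L}"
  using assms
proof (induction n arbitrary: k \<phi>)
  case 0
  then show ?case using has_integral_cos_int_freq[of k \<phi> L] by (simp add: riesz_def)
next
  case (Suc n)
  let ?R = "\<lambda>t. riesz n (\<lambda>i. 2 * pi * of_int (m i) * t + \<theta> i)"
  have "((\<lambda>t. cos (2 * pi * of_int k * t + \<phi>) * ?R t
      + (cos (2 * pi * of_int (k + m n) * t + (\<phi> + \<theta> n)) * ?R t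
        + cos (2 * pi * of_int (k - m n) * t + (\<phi> - \<theta> n)) * ?R t) / 2) has_integral 0 + (0 + 0) / 2)
      {0..real L}"
    using Suc.prems by (intro has_integral_add has_integral_divide Suc.IH) auto
  moreover have "cos (2 * pi * of_int k * t + \<phi>) * ?R t
      + (cos (2 * pi * of_int (k + m n) * t + (\<phi> + \<theta> n)) * ?R t
        + cos (2 * pi * of_int (k - m n) * t + (\<phi> - \<theta> n)) * ?R t) / 2
     = cos (2 * pi * of_int k * t + \<phi>) * riesz (Suc n) (\<lambda>i. 2 * pi * of_int (m i) * t + \<theta> i)" for t
  proof -
    have e: "2 * pi * of_int (k + m n) * t + (\<phi> + \<theta> n)
        = (2 * pi * of_int k * t + \<phi>) + (2 * pi * of_int (m n) * t + \<theta> n)"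
      "2 * pi * of_int (k - m n) * t + (\<phi> - \<theta> n)
        = (2 * pi * of_int k * t + \<phi>) - (2 * pi * of_int (m n) * t + \<theta> n)"
      by (simp_all add: algebra_simps)
    show ?thesis unfolding e cos_add cos_diff riesz_Suc by (simp add: field_simps)
  qed
  ultimately show ?case by simp
qed

lemma riesz_mean:
  fixes m :: "nat \<Rightarrow> int"
  assumes "\<And>i. i < n \<Longrightarrow> (\<Sum>l<i. \<bar>m l\<bar>) < \<bar>m i\<bar>"
  shows "((\<lambda>t. riesz n (\<lambda>i. 2 * pi * of_int (m i) * t + \<theta> i)) has_integral real L) {0..real L}"
  using assms
proof (induction n)
  case 0
  then show ?case using has_integral_const_real[of "1::real" 0 "real L"] by (simp add: riesz_def)
next
  case (Suc n)
  have "((\<lambda>t. riesz n (\<lambda>i. 2 * pi * of_int (m i) * t + \<theta> i)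
       + cos (2 * pi * of_int (m n) * t + \<theta> n) * riesz n (\<lambda>i. 2 * pi * of_int (m i) * t + \<theta> i))
       has_integral real L + 0) {0..real L}"
    using Suc.prems by (intro has_integral_add Suc.IH riesz_high_frequency) auto
  then show ?case by (simp add: riesz_Suc algebra_simps)
qed

text \<open>
  Expanding the product, the frequency \<open>m j\<close> arises only from the term \<open>cos (\<alpha> j)\<close> itself, whose
  mean square is \<open>1 / 2\<close>. The factor \<open>2\<close> in the hypothesis is what separates \<open>m n \<plusminus> m j\<close> from the
  frequencies of the first \<open>n\<close> factors.
\<close>

lemma riesz_coefficient:
  fixes m :: "nat \<Rightarrow> int"
  assumes "j < n" "\<And>i. i < n \<Longrightarrow> 2 * (\<Sum>l<i. \<bar>m l\<bar>) < \<bar>m i\<bar>"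
  shows "((\<lambda>t. cos (2 * pi * of_int (m j) * t + \<theta> j) *
            riesz n (\<lambda>i. 2 * pi * of_int (m i) * t + \<theta> i)) has_integral real L / 2) {0..real L}"
  using assms
proof (induction n)
  case 0
  then show ?case by simp
next
  case (Suc n)
  let ?a = "\<lambda>i t. 2 * pi * of_int (m i) * t + \<theta> i"
  let ?R = "\<lambda>t. riesz n (\<lambda>i. ?a i t)"
  have pos: "(\<Sum>l<i. \<bar>m l\<bar>) \<ge> 0" for i by (intro sum_nonneg) auto
  have less: "(\<Sum>l<i. \<bar>m l\<bar>) < \<bar>m i\<bar>" if "i < Suc n" for i
    using Suc.prems(2)[OF that] pos[of i] by linarith
  have mn: "2 * (\<Sum>l<n. \<bar>m l\<bar>) < \<bar>m n\<bar>" using Suc.prems by auto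
  show ?case
  proof (cases "j = n")
    case True
    have "((\<lambda>t. cos (?a n t) * ?R t + (?R t + cos (2 * pi * of_int (2 * m n) * t + 2 * \<theta> n) * ?R t) / 2)
        has_integral 0 + (real L + 0) / 2) {0..real L}"
      using mn less[of n] less
      by (intro has_integral_add has_integral_divide riesz_high_frequency riesz_mean) auto
    moreover have "cos (?a n t) * ?R t + (?R t + cos (2 * pi * of_int (2 * m n) * t + 2 * \<theta> n) * ?R t) / 2
       = cos (?a j t) * riesz (Suc n) (\<lambda>i. ?a i t)" for t
    proof -
      have e: "2 * pi * of_int (2 * m n) * t + 2 * \<theta> n = 2 * ?a n t"
        by (simp add: algebra_simps)
      show ?thesis unfolding e cos_double_cos riesz_Suc True
        by (simp add: field_simps power2_eq_square)
    qed
    ultimately show ?thesis by simp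
  next
    case False
    then have j: "j < n" using Suc.prems by auto
    have mj: "\<bar>m j\<bar> \<le> (\<Sum>l<n. \<bar>m l\<bar>)"
      using j by (intro member_le_sum) auto
    then have high: "(\<Sum>l<n. \<bar>m l\<bar>) < \<bar>m j + m n\<bar>" "(\<Sum>l<n. \<bar>m l\<bar>) < \<bar>m j - m n\<bar>"
      using mn by linarith+
    have "((\<lambda>t. cos (?a j t) * ?R t
      + (cos (2 * pi * of_int (m j + m n) * t + (\<theta> j + \<theta> n)) * ?R t
        + cos (2 * pi * of_int (m j - m n) * t + (\<theta> j - \<theta> n)) * ?R t) / 2) has_integral real L / 2 + (0 + 0) / 2)
      {0..real L}"
      using Suc.prems(2) mn mj j high
      by (intro has_integral_add has_integral_divide Suc.IH riesz_high_frequency) simp_all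
    moreover have "cos (?a j t) * ?R t
      + (cos (2 * pi * of_int (m j + m n) * t + (\<theta> j + \<theta> n)) * ?R t
        + cos (2 * pi * of_int (m j - m n) * t + (\<theta> j - \<theta> n)) * ?R t) / 2
       = cos (?a j t) * riesz (Suc n) (\<lambda>i. ?a i t)" for t
    proof -
      have e: "2 * pi * of_int (m j + m n) * t + (\<theta> j + \<theta> n) = ?a j t + ?a n t"
        "2 * pi * of_int (m j - m n) * t + (\<theta> j - \<theta> n) = ?a j t - ?a n t"
        by (simp_all add: algebra_simps)
      show ?thesis unfolding e cos_add cos_diff riesz_Suc by (simp add: field_simps)
    qed
    ultimately show ?thesis by simp
  qed
qed

lemma lacunary_sum:
  fixes m :: "nat \<Rightarrow> int"
  assumes "m 0 \<noteq> 0" "\<And>i. 3 * \<bar>m i\<bar> \<le> \<bar>m (Suc i)\<bar>"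
  shows "2 * (\<Sum>l<i. \<bar>m l\<bar>) < \<bar>m i\<bar>"
proof (induction i)
  case 0
  then show ?case using assms by simp
next
  case (Suc i)
  then show ?case using assms(2)[of i] by simp
qed

lemma lacunary_pow8: "2 * (\<Sum>l<i. \<bar>8 ^ l :: int\<bar>) < \<bar>8 ^ i\<bar>"
  by (rule lacunary_sum) auto

text \<open>
  These are the frequencies seen in the X-ray transform in direction \<open>8 ^ j\<close>: they factor as
  \<open>8 ^ i * (8 ^ i - 2 * 8 ^ j)\<close>, and each of the two regimes \<open>i < j\<close> and \<open>j \<le> i\<close> grows at least
  geometrically. The base \<open>8\<close> is large enough to keep the ratio above \<open>3\<close> also across the sign change.
\<close>

lemma lacunary_parabola: 
  fixes j :: nat
  shows "2 * (\<Sum>l<i. \<bar>64 ^ l - 2 * 8 ^ (l + j) :: int\<bar>) < \<bar>64 ^ i - 2 * 8 ^ (i + j)\<bar>"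
proof (rule lacunary_sum)
  have "(1::int) \<le> 8 ^ j" by simp
  then have "(1 - 2 * 8 ^ j :: int) \<noteq> 0" by linarith
  then show "(64 ^ 0 - 2 * 8 ^ (0 + j) :: int) \<noteq> 0" by simp
next
  fix i
  have sq: "(64::int) ^ i = 8 ^ i * 8 ^ i" for i
    by (simp flip: power_mult_distrib)
  have F: "64 ^ i - 2 * 8 ^ (i + j) = 8 ^ i * (8 ^ i - 2 * 8 ^ j :: int)" for i
    by (simp add: sq power_add algebra_simps)
  have "3 * \<bar>8 ^ i - 2 * 8 ^ j :: int\<bar> \<le> 8 * \<bar>8 * 8 ^ i - 2 * 8 ^ j\<bar>"
  proof -
    have aux: "3 * \<bar>X - 2 * Y\<bar> \<le> 8 * \<bar>8 * X - 2 * Y\<bar>"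
      if "0 < X" "0 < Y" "8 * X \<le> Y \<or> Y \<le> X" for X Y :: int
      using that by (auto simp: abs_if)
    have "8 * (8::int) ^ i \<le> 8 ^ j \<or> (8::int) ^ j \<le> 8 ^ i"
      using power_increasing[of "Suc i" j "8::int"] power_increasing[of j i "8::int"] by force
    then show ?thesis by (intro aux) auto
  qed
  then have "8 ^ i * (3 * \<bar>8 ^ i - 2 * 8 ^ j :: int\<bar>) \<le> 8 ^ i * (8 * \<bar>8 * 8 ^ i - 2 * 8 ^ j\<bar>)"
    by (intro mult_left_mono) auto
  then show "3 * \<bar>64 ^ i - 2 * 8 ^ (i + j) :: int\<bar> \<le> \<bar>64 ^ Suc i - 2 * 8 ^ (Suc i + j)\<bar>"
    unfolding F[of i] F[of "Suc i"] abs_mult by (simp add: mult_ac)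
qed

section \<open>Integration over the plane and over slices\<close>

lemma UNIV_two: "(UNIV :: 2 set) = {1, 2}"
  using exhaust_2 by auto

lemma Basis_2: "(Basis :: (real^2) set) = {axis 1 1, axis 2 1}"
  by (auto simp: Basis_vec_def UNIV_two)

lemma axis_2_neq: "axis 1 (1::real) \<noteq> (axis 2 1 :: real^2)"
  by (simp add: axis_eq_axis)

lemma vector2_measurable [measurable]:
  "(\<lambda>p. vector [fst p, snd p] :: real^2) \<in> borel_measurable (borel \<Otimes>\<^sub>M borel)"
  unfolding borel_measurable_euclidean_space[where 'c = "real^2"]
  by (auto simp: Basis_2 inner_axis)

lemma vec_nth_measurable [measurable]: "(\<lambda>x :: real^'n::finite. x $ i) \<in> borel_measurable borel"
  by (intro borel_measurable_continuous_onI continuous_intros)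

text \<open>
  Everything in the construction is a function of \<open>x $ 1\<close> times a function of \<open>x $ 2\<close>, so integrals over
  \<open>real^2\<close> are reduced to one-dimensional ones through this description of the Lebesgue measure.
\<close>

lemma lborel_2: "(lborel :: (real^2) measure) =
    distr (lborel \<Otimes>\<^sub>M lborel) borel (\<lambda>p. vector [fst p, snd p])"
proof (rule lborel_eqI)
  fix l u :: "real^2" assume le: "\<And>b. b \<in> Basis \<Longrightarrow> l \<bullet> b \<le> u \<bullet> b"
  have "(\<lambda>p. vector [fst p, snd p] :: real^2) -` box l u = {l$1<..<u$1} \<times> {l$2<..<u$2}"
    by (auto simp: box_def Basis_2 inner_axis)
  moreover have "l$1 \<le> u$1" "l$2 \<le> u$2"
    using le[of "axis 1 1"] le[of "axis 2 1"] by (auto simp: Basis_2 inner_axis)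
  ultimately show "emeasure (distr (lborel \<Otimes>\<^sub>M lborel) borel (\<lambda>p. vector [fst p, snd p])) (box l u)
      = ennreal (\<Prod>b\<in>Basis. (u - l) \<bullet> b)"
    using axis_2_neq
    by (subst emeasure_distr)
       (auto simp: space_pair_measure lborel.emeasure_pair_measure_Times Basis_2 inner_axis ennreal_mult)
qed simp

lemma nn_integral_lborel_2:
  fixes f :: "real^2 \<Rightarrow> ennreal"
  assumes [measurable]: "f \<in> borel_measurable borel"
  shows "(\<integral>\<^sup>+x. f x \<partial>lborel) = (\<integral>\<^sup>+a. \<integral>\<^sup>+b. f (vector [a, b]) \<partial>lborel \<partial>lborel)"
proof -
  have "(\<integral>\<^sup>+x. f x \<partial>lborel) = (\<integral>\<^sup>+p. f (vector [fst p, snd p]) \<partial>(lborel \<Otimes>\<^sub>M lborel))"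
    by (subst lborel_2, subst nn_integral_distr) auto
  also have "\<dots> = (\<integral>\<^sup>+a. \<integral>\<^sup>+b. f (vector [a, b]) \<partial>lborel \<partial>lborel)"
    by (subst lborel.nn_integral_fst[symmetric]) auto
  finally show ?thesis .
qed

lemma nn_integral_lborel_2_prod:
  fixes f g :: "real \<Rightarrow> ennreal"
  assumes [measurable]: "f \<in> borel_measurable borel" "g \<in> borel_measurable borel"
  shows "(\<integral>\<^sup>+x. f (x$1) * g (x$2) \<partial>(lborel :: (real^2) measure)) = (\<integral>\<^sup>+a. f a \<partial>lborel) * (\<integral>\<^sup>+b. g b \<partial>lborel)"
  by (subst nn_integral_lborel_2) (auto simp: nn_integral_cmult nn_integral_multc)

lemma
  fixes f g :: "real \<Rightarrow> 'a :: {real_normed_field, banach, second_countable_topology}"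
  assumes f: "integrable lborel f" and g: "integrable lborel g"
  shows integrable_lborel_2_prod: "integrable (lborel :: (real^2) measure) (\<lambda>x. f (x$1) * g (x$2))"
    and integral_lborel_2_prod: "(LINT x|(lborel :: (real^2) measure). f (x$1) * g (x$2))
          = (LINT a|lborel. f a) * (LINT b|lborel. g b)"
proof -
  have [measurable]: "f \<in> borel_measurable borel" "g \<in> borel_measurable borel"
    using borel_measurable_integrable[OF f] borel_measurable_integrable[OF g] by auto
  have int: "integrable (lborel \<Otimes>\<^sub>M lborel) (\<lambda>p. f (fst p) * g (snd p))"
    using f g by (intro lborel_pair.Fubini_integrable) (auto simp: norm_mult)
  show "integrable (lborel :: (real^2) measure) (\<lambda>x. f (x$1) * g (x$2))"
    using int by (subst lborel_2, subst integrable_distr_eq) auto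
  have "(LINT x|(lborel :: (real^2) measure). f (x$1) * g (x$2))
      = (LINT p|(lborel \<Otimes>\<^sub>M lborel). f (fst p) * g (snd p))"
    by (subst lborel_2, subst integral_distr) auto
  also have "\<dots> = (LINT a|lborel. LINT b|lborel. f a * g b)"
    using int by (subst lborel_pair.integral_fst'[symmetric]) auto
  finally show "(LINT x|(lborel :: (real^2) measure). f (x$1) * g (x$2))
          = (LINT a|lborel. f a) * (LINT b|lborel. g b)"
    by simp
qed

lemma ennreal_integral_le_nn_integral:
  fixes f :: "'a \<Rightarrow> real"
  assumes "integrable M f"
  shows "ennreal (LINT x|M. f x) \<le> (\<integral>\<^sup>+x. ennreal (f x) \<partial>M)"
proof -
  have "ennreal (LINT x|M. f x) \<le> ennreal (LINT x|M. max 0 (f x))"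
    using assms by (intro ennreal_leI integral_mono) auto
  also have "\<dots> = (\<integral>\<^sup>+x. ennreal (max 0 (f x)) \<partial>M)"
    using assms by (intro nn_integral_eq_integral[symmetric]) auto
  also have "\<dots> = (\<integral>\<^sup>+x. ennreal (f x) \<partial>M)"
    by (intro nn_integral_cong) (auto simp: max_def ennreal_neg)
  finally show ?thesis .
qed

lemma nn_integral_has_integral_Icc:
  fixes f :: "real \<Rightarrow> real"
  assumes c: "continuous_on {a..b} f" and nn: "\<And>x. x \<in> {a..b} \<Longrightarrow> 0 \<le> f x" and I: "(f has_integral I) {a..b}"
  shows "(\<integral>\<^sup>+x\<in>{a..b}. ennreal (f x) \<partial>lborel) = ennreal I"
proof -
  have s: "set_integrable lborel {a..b} f" by (rule borel_integrable_atLeastAtMost'[OF c])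
  have "(\<integral>\<^sup>+x\<in>{a..b}. ennreal (f x) \<partial>lborel) = (\<integral>\<^sup>+x. ennreal (indicator {a..b} x *\<^sub>R f x) \<partial>lborel)"
    by (intro nn_integral_cong) (auto split: split_indicator)
  also have "\<dots> = ennreal (LINT x:{a..b}|lborel. f x)"
    unfolding set_lebesgue_integral_def
    using s nn by (intro nn_integral_eq_integral) (auto simp: set_integrable_def split: split_indicator)
  also have "(LINT x:{a..b}|lborel. f x) = I"
    using set_borel_integral_eq_integral[OF s] I by (simp add: integral_unique)
  finally show ?thesis .
qed

text \<open>
  Lower bounds for energies come from a minorant \<open>F\<close> of the density that depends on \<open>x $ 1\<close> only and
  may be negative; \<open>ennreal\<close> truncates its negative part, which only helps.
\<close>

lemma nn_integral_square_ge:
  fixes F :: "real \<Rightarrow> real" and G :: "real^2 \<Rightarrow> ennreal"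
  assumes c: "continuous_on {0..real L} F" and I: "(F has_integral I) {0..real L}"
    and A: "\<And>x. x$1 \<in> {0..real L} \<Longrightarrow> x$2 \<in> {0..real L} \<Longrightarrow> ennreal (F (x$1)) \<le> G x"
  shows "ennreal (real L * I) \<le> (\<integral>\<^sup>+x. G x \<partial>lborel)"
proof -
  have s: "set_integrable lborel {0..real L} F" by (rule borel_integrable_atLeastAtMost'[OF c])
  have [measurable]: "(\<lambda>x. indicator {0..real L} x * F x) \<in> borel_measurable borel"
    using s by (auto simp: set_integrable_def)
  have "ennreal I = ennreal (LINT x|lborel. indicator {0..real L} x * F x)"
    using set_borel_integral_eq_integral[OF s] I by (simp add: integral_unique set_lebesgue_integral_def)
  also have "\<dots> \<le> (\<integral>\<^sup>+x. ennreal (indicator {0..real L} x * F x) \<partial>lborel)"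
    using s by (intro ennreal_integral_le_nn_integral) (auto simp: set_integrable_def)
  finally have "ennreal I * ennreal (real L)
     \<le> (\<integral>\<^sup>+x. ennreal (indicator {0..real L} x * F x) \<partial>lborel) * (\<integral>\<^sup>+x. indicator {0..real L} x \<partial>lborel)"
    by (auto intro!: mult_mono)
  also have "\<dots> = (\<integral>\<^sup>+x. ennreal (indicator {0..real L} (x$1) * F (x$1)) * indicator {0..real L} (x$2)
      \<partial>(lborel :: (real^2) measure))"
    by (subst nn_integral_lborel_2_prod) auto
  also have "\<dots> \<le> (\<integral>\<^sup>+x. G x \<partial>lborel)"
    using A by (intro nn_integral_mono) (auto split: split_indicator)
  finally have "ennreal I * ennreal (real L) \<le> (\<integral>\<^sup>+x. G x \<partial>lborel)" .
  then show ?thesis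
    by (cases "0 \<le> I") (auto simp: ennreal_mult mult.commute ennreal_neg mult_nonpos_nonneg)
qed

section \<open>The weight and its slices\<close>

definition phase :: "nat \<Rightarrow> real \<Rightarrow> real \<Rightarrow> real" where
  "phase i x t = 2 * pi * (8 ^ i * x + 64 ^ i * t)"

definition riesz_weight :: "nat \<Rightarrow> (real^2) \<times> real \<Rightarrow> real" where
  "riesz_weight n z = riesz n (\<lambda>i. phase i (fst z $ 1) (snd z))"

lemma phase_alt: "phase i x t = 2 * pi * of_int (8 ^ i) * x + 2 * pi * 64 ^ i * t"
  by (simp add: phase_def algebra_simps)

lemma lacunary_pow8_less: "(\<Sum>l<i. \<bar>8 ^ l :: int\<bar>) < \<bar>8 ^ i\<bar>"
  using lacunary_pow8[of i] sum_nonneg[of "{..<i}" "\<lambda>l. \<bar>8 ^ l :: int\<bar>"] by simp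

lemma riesz_slice_mean: "((\<lambda>x. riesz n (\<lambda>i. phase i x t)) has_integral real L) {0..real L}"
  unfolding phase_alt by (rule riesz_mean) (rule lacunary_pow8_less)

lemma riesz_slice_coefficient:
  "j < n \<Longrightarrow> ((\<lambda>x. cos (phase j x t) * riesz n (\<lambda>i. phase i x t)) has_integral real L / 2) {0..real L}"
  unfolding phase_alt by (rule riesz_coefficient) (use lacunary_pow8 in auto)

text \<open>
  With \<open>b = n\<^sup>2 / 4\<close> this is the integral of the quadratic minorant of \<open>\<bar>u\<bar>\<^sup>2 * w\<close>; other values of
  \<open>b\<close> leave room for the errors in the Euclidean setting.
\<close>

lemma riesz_slice_energy:
  "((\<lambda>x. (real n * (\<Sum>j<n. cos (phase j x t)) - b) * riesz n (\<lambda>i. phase i x t))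
      has_integral real L * ((real n)\<^sup>2 / 2 - b)) {0..real L}"
proof -
  have "((\<lambda>x. real n * (\<Sum>j<n. cos (phase j x t) * riesz n (\<lambda>i. phase i x t)) - b * riesz n (\<lambda>i. phase i x t))
      has_integral real n * (\<Sum>j<n. real L / 2) - b * real L) {0..real L}"
    by (intro has_integral_diff has_integral_mult_right has_integral_sum riesz_slice_mean riesz_slice_coefficient) auto
  then show ?thesis by (simp add: algebra_simps power2_eq_square flip: sum_distrib_right)
qed

text \<open>
  Along the line with direction \<open>8 ^ j\<close> the weight is again a Riesz product, so its mean is exactly \<open>1\<close>
  no matter where the line starts.
\<close>

lemma riesz_xray:
  "((\<lambda>t. riesz n (\<lambda>i. phase i (x - 2 * t * 8 ^ j) t)) has_integral 1) {0..1}"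
proof -
  have "phase i (x - 2 * t * 8 ^ j) t = 2 * pi * of_int (64 ^ i - 2 * 8 ^ (i + j)) * t + 2 * pi * 8 ^ i * x" for i t
    by (simp add: phase_def power_add algebra_simps)
  moreover have "(\<Sum>l<i. \<bar>64 ^ l - 2 * 8 ^ (l + j) :: int\<bar>) < \<bar>64 ^ i - 2 * 8 ^ (i + j)\<bar>" for i
    using lacunary_parabola[of j i] sum_nonneg[of "{..<i}" "\<lambda>l. \<bar>64 ^ l - 2 * 8 ^ (l + j) :: int\<bar>"] by simp
  ultimately show ?thesis
    using riesz_mean[of n "\<lambda>i. 64 ^ i - 2 * 8 ^ (i + j)" "\<lambda>i. 2 * pi * 8 ^ i * x" 1] by simp
qed

lemma continuous_on_phase [continuous_intros]:
  "continuous_on S f \<Longrightarrow> continuous_on S g \<Longrightarrow> continuous_on S (\<lambda>z. phase i (f z) (g z))"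
  unfolding phase_def by (intro continuous_intros)

lemma continuous_on_riesz [continuous_intros]:
  fixes f :: "nat \<Rightarrow> 'a::t2_space \<Rightarrow> real"
  shows "(\<And>i. i < n \<Longrightarrow> continuous_on S (\<lambda>z. f i z)) \<Longrightarrow> continuous_on S (\<lambda>z. riesz n (\<lambda>i. f i z))"
  unfolding riesz_def
  by (intro continuous_on_prod continuous_on_add continuous_on_const continuous_on_cos) auto

lemma continuous_riesz_weight: "continuous_on S (riesz_weight n)"
  unfolding riesz_weight_def by (intro continuous_intros)

lemma periodic_riesz_weight: "periodic_weight (riesz_weight n)"
proof -
  have cos_per: "cos (a + 2 * pi * of_int k) = cos a" for a and k :: int
    using cos_int_2pin[of k] sin_int_2pin[of k] by (simp add: cos_add)
  have "set_integrable lborel K (riesz_weight n)" if "compact K" for K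
    unfolding set_integrable_def by (intro borel_integrable_compact that continuous_riesz_weight)
  moreover have "riesz_weight n (x + of_int_vec k, t + of_int m) = riesz_weight n (x, t)"
    for x t and k :: "int ^ 2" and m :: int
  proof -
    have "phase i ((x + of_int_vec k) $ 1) (t + of_int m) = phase i (x $ 1) t + 2 * pi * of_int (8 ^ i * k $ 1 + 64 ^ i * m)" for i
      by (simp add: phase_def of_int_vec_def algebra_simps)
    then show ?thesis by (simp add: riesz_weight_def riesz_def cos_per del: of_int_add of_int_mult)
  qed
  ultimately show ?thesis
    unfolding periodic_weight_def weight_def
    using borel_measurable_continuous_onI[OF continuous_riesz_weight] riesz_nonneg
    by (auto simp: riesz_weight_def)
qed

lemma norm_sum_cis: "(norm (\<Sum>i<n. cis (a i)))\<^sup>2 = (\<Sum>i<n. \<Sum>j<n. cos (a i - a j))"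
proof -
  have "(norm (\<Sum>i<n. cis (a i)))\<^sup>2 = (\<Sum>i<n. cos (a i))\<^sup>2 + (\<Sum>i<n. sin (a i))\<^sup>2"
    by (simp add: cmod_power2 Re_sum Im_sum)
  also have "\<dots> = (\<Sum>i<n. \<Sum>j<n. cos (a i - a j))"
    by (simp add: power2_eq_square sum_product cos_diff sum.distrib)
  finally show ?thesis .
qed

lemma orthogonality_sum_cis:
  fixes m :: "nat \<Rightarrow> int"
  assumes "inj_on m {..<n}"
  shows "((\<lambda>s. (norm (\<Sum>i<n. cis (2 * pi * of_int (m i) * s + \<theta> i)))\<^sup>2) has_integral real n) {0..1}"
proof -
  have "((\<lambda>s. cos ((2 * pi * of_int (m i) * s + \<theta> i) - (2 * pi * of_int (m j) * s + \<theta> j)))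
      has_integral (if i = j then 1 else 0)) {0..1}" if "i < n" "j < n" for i j
  proof (cases "i = j")
    case True
    then show ?thesis using has_integral_const_real[of "1::real" 0 1] by simp
  next
    case False
    then have "m i - m j \<noteq> 0" using assms that by (auto simp: inj_on_def)
    from has_integral_cos_int_freq[OF this, of "\<theta> i - \<theta> j" 1] False show ?thesis
      by (simp add: algebra_simps)
  qed
  then have "((\<lambda>s. \<Sum>i<n. \<Sum>j<n. cos ((2 * pi * of_int (m i) * s + \<theta> i) - (2 * pi * of_int (m j) * s + \<theta> j)))
      has_integral (\<Sum>i<n. \<Sum>j<n. if i = j then 1 else 0)) {0..1}"
    by (intro has_integral_sum) auto
  then show ?thesis unfolding norm_sum_cis by simp
qed

text \<open>
  Completing the square replaces \<open>\<bar>z\<bar>\<^sup>2\<close> by something linear in \<open>z\<close>, so that the energy only involves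
  Fourier coefficients of the weight. It is sharp for \<open>z = c\<close>, the value that \<open>u\<close> takes on average
  with respect to the weight.
\<close>

lemma square_minorant: "2 * c * Re z - c\<^sup>2 \<le> (norm z)\<^sup>2"
proof -
  have "(Re z)\<^sup>2 \<le> (norm z)\<^sup>2" by (simp add: cmod_power2)
  moreover have "0 \<le> (Re z - c)\<^sup>2" by simp
  ultimately show ?thesis by (simp add: power2_diff algebra_simps)
qed

lemma ennreal_divide_le_admissible:
  assumes "ennreal a \<le> C * ennreal b" "0 < b"
  shows "ennreal (a / b) \<le> C"
proof (cases C)
  case (real c)
  then have "ennreal a \<le> ennreal (c * b)" using assms by (simp add: ennreal_mult)
  then have "a \<le> c * b" using real assms by (cases "0 \<le> a") (auto simp: ennreal_le_iff)
  then show ?thesis using real assms by (auto intro!: ennreal_leI simp: field_simps)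
qed simp

section \<open>Lower bounds on the torus\<close>

definition torus_datum :: "nat \<Rightarrow> real^2 \<Rightarrow> complex" where
  "torus_datum n x = (\<Sum>i<n. cis (2 * pi * 8 ^ i * x $ 1))"

definition torus_freq :: "nat \<Rightarrow> int^2" where
  "torus_freq i = vector [8 ^ i, 0]"

lemma torus_freq_nth [simp]: "torus_freq i $ 1 = 8 ^ i" "torus_freq i $ 2 = 0"
  by (simp_all add: torus_freq_def)

lemma inj_torus_freq: "inj torus_freq"
  by (rule injI) (metis torus_freq_nth(1) power_inject_exp numeral_less_iff one_less_numeral_iff semiring_norm(76))

lemma eq_torus_freq_iff: "k = torus_freq i \<longleftrightarrow> k $ 1 = 8 ^ i \<and> k $ 2 = 0"
  by (auto simp: vec_eq_iff UNIV_2 forall_2)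

lemma inner_2: "x \<bullet> y = x $ 1 * y $ 1 + x $ 2 * y $ (2::2)" for x y :: "real^2"
  by (simp add: inner_vec_def UNIV_2)

lemma norm_2: "(norm x)\<^sup>2 = (x $ 1)\<^sup>2 + (x $ 2)\<^sup>2" for x :: "real^2"
  unfolding power2_norm_eq_inner inner_2 by (simp add: power2_eq_square)

lemma trig_polynomial_torus_datum: "trig_polynomial (torus_datum n)"
  unfolding trig_polynomial_def
proof (intro exI conjI)
  show "finite (torus_freq ` {..<n})" by simp
  show "torus_datum n = (\<lambda>x. \<Sum>k\<in>torus_freq ` {..<n}. 1 * cis (2 * pi * (x \<bullet> of_int_vec k)))"
    by (subst sum.reindex)
       (auto intro: inj_on_subset[OF inj_torus_freq] simp: torus_datum_def inner_2 of_int_vec_def algebra_simps fun_eq_iff)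
qed

lemma integral_cis_int_freq:
  fixes l :: int
  shows "set_integrable lborel {0..1} (\<lambda>x. cis (2 * pi * of_int l * x))"
    and "(LINT x:{0..1}|lborel. cis (2 * pi * of_int l * x)) = (if l = 0 then 1 else 0)"
proof -
  show s: "set_integrable lborel {0..1} (\<lambda>x. cis (2 * pi * of_int l * x))"
    by (intro borel_integrable_atLeastAtMost' continuous_intros)
  have "((\<lambda>x. cis (2 * pi * of_int l * x)) has_integral (if l = 0 then 1 else 0)) {0..1}"
  proof (cases "l = 0")
    case True
    then show ?thesis using has_integral_const_real[of "1::complex" 0 1] by simp
  next
    case False
    \<comment> \<open>The sine is a cosine with phase \<open>- pi / 2\<close>, so both parts fall under one lemma.\<close>
    have e: "cis a = complex_of_real (cos (a + 0)) + \<i> * complex_of_real (cos (a + (- pi / 2)))" for a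
      by (simp add: complex_eq_iff cos_diff)
    have "((\<lambda>x. cis (2 * pi * of_int l * x)) has_integral complex_of_real 0 + \<i> * complex_of_real 0) {0..1}"
      unfolding e
      using has_integral_cos_int_freq[OF False, of 0 1] has_integral_cos_int_freq[OF False, of "- pi / 2" 1]
      by (intro has_integral_add has_integral_mult_right has_integral_of_real) auto
    then show ?thesis using False by simp
  qed
  then show "(LINT x:{0..1}|lborel. cis (2 * pi * of_int l * x)) = (if l = 0 then 1 else 0)"
    using set_borel_integral_eq_integral[OF s] by (simp add: integral_unique)
qed

lemma unit_cube_2: "unit_cube = {x :: real^2. x $ 1 \<in> {0..1} \<and> x $ 2 \<in> {0..1}}"
  by (auto simp: unit_cube_def forall_2)

lemma fourier_coeff_torus_datum:
  "fourier_coeff (torus_datum n) k = (if k \<in> torus_freq ` {..<n} then 1 else 0)"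
proof -
  let ?e = "\<lambda>l x. indicat_real {0..1} x *\<^sub>R cis (2 * pi * of_int l * x)"
  have int: "integrable lborel (?e l)" for l
    using integral_cis_int_freq(1) by (simp add: set_integrable_def)
  have val: "(LINT x|lborel. ?e l x) = (if l = 0 then 1 else 0)" for l
    using integral_cis_int_freq(2) by (simp add: set_lebesgue_integral_def)
  have "fourier_coeff (torus_datum n) k
      = (LINT x|(lborel :: (real^2) measure). (\<Sum>i<n. ?e (8 ^ i - k $ 1) (x $ 1) * ?e (- k $ 2) (x $ 2)))"
    unfolding fourier_coeff_def set_lebesgue_integral_def
  proof (intro Bochner_Integration.integral_cong refl)
    fix x :: "real^2"
    have "cis (2 * pi * 8 ^ i * x $ 1) * cis (- 2 * pi * (x \<bullet> of_int_vec k))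
       = cis (2 * pi * of_int (8 ^ i - k $ 1) * x $ 1) * cis (2 * pi * of_int (- k $ 2) * x $ 2)" for i
      by (simp add: cis_mult inner_2 of_int_vec_def algebra_simps)
    then show "indicat_real unit_cube x *\<^sub>R (torus_datum n x * cis (- 2 * pi * (x \<bullet> of_int_vec k)))
       = (\<Sum>i<n. ?e (8 ^ i - k $ 1) (x $ 1) * ?e (- k $ 2) (x $ 2))"
      by (simp add: torus_datum_def sum_distrib_right unit_cube_2 indicator_def)
  qed
  also have "\<dots> = (\<Sum>i<n. (LINT x|(lborel :: (real^2) measure). ?e (8 ^ i - k $ 1) (x $ 1) * ?e (- k $ 2) (x $ 2)))"
    by (intro Bochner_Integration.integral_sum integrable_lborel_2_prod int)
  also have "\<dots> = (\<Sum>i<n. if k = torus_freq i then 1 else 0)"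
    unfolding integral_lborel_2_prod[OF int int] val
    by (intro sum.cong refl) (auto simp: eq_torus_freq_iff)
  also have "\<dots> = (if k \<in> torus_freq ` {..<n} then 1 else 0)"
  proof (cases "k \<in> torus_freq ` {..<n}")
    case True
    then obtain j where j: "j < n" "k = torus_freq j" by auto
    have "(\<Sum>i<n. if k = torus_freq i then 1 else 0) = (\<Sum>i<n. if i = j then 1 else (0::complex))"
      using inj_torus_freq j by (intro sum.cong refl) (auto simp: inj_def)
    then show ?thesis using j True by simp
  next
    case False
    then have "(\<Sum>i<n. if k = torus_freq i then 1 else 0) = (0::complex)"
      by (intro sum.neutral) auto
    then show ?thesis using False by simp
  qed
  finally show ?thesis .
qed

lemma fourier_support_torus_datum: "fourier_support (torus_datum n) = torus_freq ` {..<n}"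
  by (auto simp: fourier_support_def fourier_coeff_torus_datum)

lemma schroedinger_torus_datum:
  "schroedinger_T (torus_datum n) x t = (\<Sum>i<n. cis (phase i (x $ 1) t))"
proof -
  let ?f = "\<lambda>k. cis (2 * pi * (x \<bullet> of_int_vec k + t * (norm (of_int_vec k :: real^2))\<^sup>2))"
  have "schroedinger_T (torus_datum n) x t = (\<Sum>\<^sub>\<infinity>k\<in>torus_freq ` {..<n}. ?f k)"
    unfolding schroedinger_T_def
    by (rule infsum_cong_neutral) (auto simp: fourier_coeff_torus_datum)
  also have "\<dots> = (\<Sum>i<n. ?f (torus_freq i))"
    by (subst infsum_finite, simp, subst sum.reindex) (auto intro: inj_on_subset[OF inj_torus_freq])
  also have "\<dots> = (\<Sum>i<n. cis (phase i (x $ 1) t))"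
    by (simp add: inner_2 norm_2 of_int_vec_def phase_def algebra_simps flip: power_mult_distrib)
       (simp add: power2_eq_square flip: power_mult_distrib)
  finally show ?thesis .
qed

lemma xray_torus: "xray_T (riesz_weight n) x (torus_freq j) = 1"
proof -
  have "(\<integral>\<^sup>+t\<in>{0..1}. ennreal (riesz n (\<lambda>i. phase i (x $ 1 - 2 * t * 8 ^ j) t)) \<partial>lborel) = ennreal 1"
    by (rule nn_integral_has_integral_Icc) (auto intro!: continuous_intros riesz_xray riesz_nonneg)
  then show ?thesis
    by (simp add: xray_T_def riesz_weight_def of_int_vec_def algebra_simps)
qed

lemma L2_norm_sq_torus_datum: "L2_norm_sq unit_cube (torus_datum n) = ennreal (real n)"
proof -
  have c: "continuous_on S (\<lambda>s. (norm (\<Sum>i<n. cis (2 * pi * 8 ^ i * s)))\<^sup>2)" for S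
    by (intro continuous_intros)
  have [measurable]: "(\<lambda>s. (norm (\<Sum>i<n. cis (2 * pi * 8 ^ i * s)))\<^sup>2) \<in> borel_measurable borel"
    by (intro borel_measurable_continuous_onI c)
  have "L2_norm_sq unit_cube (torus_datum n) =
     (\<integral>\<^sup>+x. (ennreal ((norm (\<Sum>i<n. cis (2 * pi * 8 ^ i * x $ 1)))\<^sup>2) * indicator {0..1} (x $ 1))
        * indicator {0..1} (x $ 2) \<partial>(lborel :: (real^2) measure))"
    unfolding L2_norm_sq_def torus_datum_def
    by (intro nn_integral_cong) (auto simp: unit_cube_2 indicator_def)
  also have "\<dots> = (\<integral>\<^sup>+s\<in>{0..1}. ennreal ((norm (\<Sum>i<n. cis (2 * pi * 8 ^ i * s)))\<^sup>2) \<partial>lborel)"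
    by (subst nn_integral_lborel_2_prod[where g = "indicator {0..1}"]) auto
  also have "\<dots> = ennreal (real n)"
    using orthogonality_sum_cis[of "\<lambda>i. 8 ^ i" n "\<lambda>_. 0"]
    by (intro nn_integral_has_integral_Icc c) (auto simp: inj_on_def)
  finally show ?thesis .
qed

lemma energy_torus: "ennreal ((real n)\<^sup>2 / 4) \<le> energy_T (torus_datum n) (riesz_weight n)"
proof -
  let ?F = "\<lambda>t x. (real n * (\<Sum>j<n. cos (phase j x t)) - (real n)\<^sup>2 / 4) * riesz n (\<lambda>i. phase i x t)"
  let ?G = "\<lambda>t x. ennreal ((norm (schroedinger_T (torus_datum n) x t))\<^sup>2 * riesz_weight n (x, t))"
  have slice: "ennreal ((real n)\<^sup>2 / 4) \<le> (\<integral>\<^sup>+x\<in>unit_cube. ?G t x \<partial>lborel)" for t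
  proof -
    have "ennreal (real 1 * (real 1 * ((real n)\<^sup>2 / 2 - (real n)\<^sup>2 / 4))) \<le> (\<integral>\<^sup>+x\<in>unit_cube. ?G t x \<partial>lborel)"
    proof (rule nn_integral_square_ge[OF _ riesz_slice_energy[where t = t]])
      fix x :: "real^2" assume x: "x $ 1 \<in> {0..real 1}" "x $ 2 \<in> {0..real 1}"
      have "real n * (\<Sum>j<n. cos (phase j (x $ 1) t)) - (real n)\<^sup>2 / 4
          \<le> (norm (schroedinger_T (torus_datum n) x t))\<^sup>2"
        using square_minorant[of "real n / 2" "schroedinger_T (torus_datum n) x t"]
        by (simp add: schroedinger_torus_datum Re_sum power_divide)
      then have "?F t (x $ 1) \<le> (norm (schroedinger_T (torus_datum n) x t))\<^sup>2 * riesz_weight n (x, t)"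
        unfolding riesz_weight_def fst_conv snd_conv by (intro mult_right_mono riesz_nonneg)
      then show "ennreal (?F t (x $ 1)) \<le> ?G t x * indicator unit_cube x"
        using x by (simp add: unit_cube_2 ennreal_leI)
    qed (intro continuous_intros)
    then show ?thesis by simp
  qed
  have "ennreal ((real n)\<^sup>2 / 4) = (\<integral>\<^sup>+t\<in>{0..1}. ennreal ((real n)\<^sup>2 / 4) \<partial>(lborel :: real measure))"
    by (simp add: nn_integral_cmult)
  also have "\<dots> \<le> (\<integral>\<^sup>+t\<in>{0..1}. (\<integral>\<^sup>+x\<in>unit_cube. ?G t x \<partial>lborel) \<partial>lborel)"
    by (intro nn_integral_mono mult_right_mono slice) auto
  finally show ?thesis unfolding energy_T_def .
qed

lemma torus_support_box:
  assumes "8 ^ n \<le> N"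
  shows "fourier_support (torus_datum n) \<subseteq> box_T N"
proof -
  have "(8::real) ^ i \<le> N" if "i < n" for i
    using power_increasing[of i n "8::real"] that assms by linarith
  moreover have "0 \<le> N" using assms by (meson order_trans zero_le_power zero_le_numeral)
  moreover have "- N \<le> 8 ^ i" for i 
    using \<open>0 \<le> N\<close> by (meson neg_le_0_iff_le order_trans zero_le_power zero_le_numeral)
  ultimately show ?thesis
    by (auto simp: fourier_support_torus_datum box_T_def box_R_def of_int_vec_def forall_2)
qed

lemma torus_constants_ge:
  assumes "1 \<le> n" "8 ^ n \<le> N"
  shows "ennreal (real n / 4) \<le> S_T TYPE(2) N" "ennreal (real n / 4) \<le> M_T TYPE(2) N"
proof -
  have n: "real n > 0" "(real n)\<^sup>2 / 4 / real n = real n / 4"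
    using assms by (auto simp: power2_eq_square)
  note hyps = periodic_riesz_weight trig_polynomial_torus_datum torus_support_box[OF assms(2)]
  have S: "(\<Sum>\<^sub>\<infinity>k. ennreal ((norm (fourier_coeff (torus_datum n) k))\<^sup>2) * (SUP x. xray_T (riesz_weight n) x k)) = ennreal n"
  proof -
    have "(\<Sum>\<^sub>\<infinity>k. ennreal ((norm (fourier_coeff (torus_datum n) k))\<^sup>2) * (SUP x. xray_T (riesz_weight n) x k))
       = (\<Sum>\<^sub>\<infinity>k\<in>torus_freq ` {..<n}. 1)"
      by (rule infsum_cong_neutral) (auto simp: fourier_coeff_torus_datum xray_torus)
    also have "\<dots> = ennreal n"
      by (simp add: card_image inj_on_subset[OF inj_torus_freq] ennreal_of_nat_eq_real_of_nat)
    finally show ?thesis .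
  qed
  show "ennreal (real n / 4) \<le> S_T TYPE(2) N"
    unfolding S_T_def
  proof (rule Inf_greatest, clarify)
    fix C assume "\<forall>w u0. periodic_weight w \<longrightarrow> trig_polynomial u0 \<longrightarrow> fourier_support u0 \<subseteq> box_T N \<longrightarrow>
       energy_T u0 w \<le> C * (\<Sum>\<^sub>\<infinity>k. ennreal ((norm (fourier_coeff u0 k :: complex))\<^sup>2) * (SUP x :: real^2. xray_T w x k))"
    with hyps have "energy_T (torus_datum n) (riesz_weight n) \<le> C * ennreal n"
      unfolding S[symmetric] by blast
    with energy_torus have "ennreal ((real n)\<^sup>2 / 4) \<le> C * ennreal n" by (rule order_trans)
    from ennreal_divide_le_admissible[OF this n(1)] show "ennreal (real n / 4) \<le> C" unfolding n(2) .
  qed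
  show "ennreal (real n / 4) \<le> M_T TYPE(2) N"
    unfolding M_T_def
  proof (rule Inf_greatest, clarify)
    fix C assume "\<forall>w u0. periodic_weight w \<longrightarrow> trig_polynomial u0 \<longrightarrow> fourier_support u0 \<subseteq> box_T N \<longrightarrow>
       energy_T u0 w \<le> C * (SUP (x :: real^2, k) \<in> UNIV \<times> fourier_support u0. xray_T w x k) * L2_norm_sq unit_cube u0"
    with hyps have "energy_T (torus_datum n) (riesz_weight n) \<le> C * 
      (SUP (x, k) \<in> UNIV \<times> fourier_support (torus_datum n). xray_T (riesz_weight n) x k) * ennreal n"
      unfolding L2_norm_sq_torus_datum[symmetric] by blast
    also have "\<dots> \<le> C * 1 * ennreal n"
      by (intro mult_mono SUP_least) (auto simp: fourier_support_torus_datum xray_torus)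
    finally have "energy_T (torus_datum n) (riesz_weight n) \<le> C * ennreal n" by simp
    with energy_torus have "ennreal ((real n)\<^sup>2 / 4) \<le> C * ennreal n" by (rule order_trans)
    from ennreal_divide_le_admissible[OF this n(1)] show "ennreal (real n / 4) \<le> C" unfolding n(2) .
  qed
qed

section \<open>A datum with compactly supported Fourier transform\<close>

lemma one_minus_cos_le: "(1 - cos y) * (1 + y\<^sup>2) \<le> 4 * y\<^sup>2" for y :: real
proof -
  have "1 - cos y = 2 * (sin (y / 2))\<^sup>2" using cos_double_sin[of "y / 2"] by simp
  moreover have "(sin (y / 2))\<^sup>2 \<le> (y / 2)\<^sup>2"
    by (rule abs_le_square_iff[THEN iffD1, OF abs_sin_x_le_abs_x])
  ultimately have "1 - cos y \<le> y\<^sup>2 / 2" by (simp add: power_divide)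
  moreover have "(1 - cos y) * y\<^sup>2 \<le> 2 * y\<^sup>2"
    by (intro mult_right_mono) (use cos_ge_minus_one[of y] in linarith, simp)
  moreover have "0 \<le> y\<^sup>2" by simp
  moreover have "(1 - cos y) * (1 + y\<^sup>2) = (1 - cos y) + (1 - cos y) * y\<^sup>2" by (simp add: distrib_left)
  ultimately show ?thesis by linarith
qed

lemma one_minus_cos_div_le: "(1 - cos y) / y\<^sup>2 \<le> 4 / (1 + y\<^sup>2)" for y :: real
  using one_minus_cos_le[of y] by (cases "y = 0") (auto simp: field_simps add_pos_nonneg)

lemma integrable_cauchy: "integrable lborel (\<lambda>x::real. 1 / (1 + x\<^sup>2))"
  using integrable_inverse_1_plus_square by (simp add: set_integrable_def inverse_eq_divide)

lemma integral_cauchy: "(LINT x|lborel. 1 / (1 + x\<^sup>2)) = pi"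
  using LBINT_inverse_1_plus_square
  by (simp add: interval_lebesgue_integral_def set_lebesgue_integral_def inverse_eq_divide)

text \<open>
  Replacing \<open>cos x\<close> by \<open>cos (a * x)\<close> multiplies this integral by \<open>\<bar>a\<bar>\<close>, and that scaling law determines
  the Fourier transform of the Fejer kernel up to this constant factor (whose value is \<open>pi\<close>).
\<close>

definition fejer_mass :: real where
  "fejer_mass = (LINT x|lborel. (1 - cos x) / x\<^sup>2)"

lemma integrable_fejer1: "integrable lborel (\<lambda>x::real. (1 - cos x) / x\<^sup>2)"
proof (rule Bochner_Integration.integrable_bound)
  show "integrable lborel (\<lambda>x::real. 4 * (1 / (1 + x\<^sup>2)))"
    by (intro integrable_mult_right integrable_cauchy)
  show "AE x in lborel. norm ((1 - cos x) / x\<^sup>2) \<le> norm (4 * (1 / (1 + x\<^sup>2)) :: real)"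
    using one_minus_cos_div_le by (intro AE_I2) (auto simp: abs_of_nonneg add_nonneg_nonneg)
qed simp

lemma fejer_mass_pos: "0 < fejer_mass"
proof -
  have "cos (1::real) < 1" using cos_monotone_0_pi[of 0 1] pi_gt3 by simp
  then have "0 < (1 - cos (1::real)) / 4" by simp
  also have "(1 - cos (1::real)) / 4 = (LINT x|lborel. indicat_real {1..2::real} x * ((1 - cos 1) / 4))"
    by simp
  also have "\<dots> \<le> fejer_mass"
    unfolding fejer_mass_def
  proof (rule integral_mono[OF _ integrable_fejer1])
    show "integrable lborel (\<lambda>x. indicat_real {1..2::real} x * ((1 - cos 1) / 4))" by simp
    fix x :: real
    show "indicat_real {1..2::real} x * ((1 - cos 1) / 4) \<le> (1 - cos x) / x\<^sup>2"
    proof (cases "x \<in> {1..2}")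
      case True
      then have "cos x \<le> cos 1" using pi_gt3 by (intro cos_monotone_0_pi_le) auto
      moreover have "x\<^sup>2 \<le> 2\<^sup>2" using True by (intro power_mono) auto
      moreover have "0 < x\<^sup>2" using True by auto
      ultimately have "(1 - cos 1) / 4 \<le> (1 - cos x) / x\<^sup>2"
        using \<open>cos (1::real) < 1\<close> by (intro frac_le) auto
      then show ?thesis using True by simp
    qed simp
  qed
  finally show ?thesis .
qed

lemma fejer_scaled:
  shows integrable_fejer_scaled: "integrable lborel (\<lambda>x. (1 - cos (a * x)) / x\<^sup>2)"
    and integral_fejer_scaled: "(LINT x|lborel. (1 - cos (a * x)) / x\<^sup>2) = \<bar>a\<bar> * fejer_mass"
proof -
  have "integrable lborel (\<lambda>x. (1 - cos (a * x)) / x\<^sup>2)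
     \<and> (LINT x|lborel. (1 - cos (a * x)) / x\<^sup>2) = \<bar>a\<bar> * fejer_mass"
  proof (cases "a = 0")
    case False
    have e: "(1 - cos (a * x)) / x\<^sup>2 = a\<^sup>2 * ((1 - cos (0 + a * x)) / (0 + a * x)\<^sup>2)" for x
      using False by (simp add: power_mult_distrib)
    have int: "integrable lborel (\<lambda>x. (1 - cos (0 + a * x)) / (0 + a * x)\<^sup>2)"
      using lborel_integrable_real_affine[OF integrable_fejer1 False, of 0] .
    have mass: "fejer_mass = \<bar>a\<bar> * (LINT x|lborel. (1 - cos (0 + a * x)) / (0 + a * x)\<^sup>2)"
      unfolding fejer_mass_def using lborel_integral_real_affine[OF False, of "\<lambda>x. (1 - cos x) / x\<^sup>2" 0] by simp
    have sq: "a\<^sup>2 = \<bar>a\<bar> * \<bar>a\<bar>" by (simp add: power2_eq_square)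
    show ?thesis
      unfolding e integral_mult_right_zero mass using integrable_mult_right[OF int, of "a\<^sup>2"]
      by (simp only: sq mult.assoc)
  qed simp
  then show "integrable lborel (\<lambda>x. (1 - cos (a * x)) / x\<^sup>2)"
    "(LINT x|lborel. (1 - cos (a * x)) / x\<^sup>2) = \<bar>a\<bar> * fejer_mass" by auto
qed

definition fejer :: "real \<Rightarrow> real \<Rightarrow> real" where
  "fejer \<delta> x = (1 - cos (2 * pi * \<delta> * x)) / x\<^sup>2"

text \<open>
  The Fourier transform of \<open>fejer \<delta>\<close>, a triangle function supported in \<open>[-\<delta>, \<delta>]\<close>.
\<close>

definition fejer_hat :: "real \<Rightarrow> real \<Rightarrow> real" where
  "fejer_hat \<delta> \<xi> = 2 * pi * fejer_mass * max 0 (\<delta> - \<bar>\<xi>\<bar>)"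

lemma fejer_nonneg: "0 \<le> fejer \<delta> x"
  by (simp add: fejer_def)

lemma integrable_fejer: "integrable lborel (fejer \<delta>)"
  unfolding fejer_def[abs_def] by (rule integrable_fejer_scaled)

lemma measurable_fejer [measurable]: "fejer \<delta> \<in> borel_measurable borel"
  using integrable_fejer by (auto dest: borel_measurable_integrable)

lemma integrable_fejer_cis: "integrable lborel (\<lambda>x. complex_of_real (fejer \<delta> x) * cis (b * x))"
proof (rule Bochner_Integration.integrable_bound[OF integrable_fejer[of \<delta>]])
  have "(\<lambda>x. cis (b * x)) \<in> borel_measurable borel"
    by (intro borel_measurable_continuous_onI continuous_intros)
  then show "(\<lambda>x. complex_of_real (fejer \<delta> x) * cis (b * x)) \<in> borel_measurable lborel"
    by simp
qed (auto simp: norm_mult)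

text \<open>
  The product \<open>(1 - cos A) * cos B\<close> is a combination of terms \<open>1 - cos (B \<plusminus> A)\<close> and \<open>1 - cos B\<close>, each of
  which integrates to a multiple of an absolute value; their second difference is the triangle function.
\<close>

lemma fejer_cos_integral:
  assumes "0 < \<delta>"
  shows "(LINT x|lborel. fejer \<delta> x * cos (2 * pi * \<xi> * x)) = fejer_hat \<delta> \<xi>"
proof -
  define h where "h a x = (1 - cos (2 * pi * a * x)) / x\<^sup>2" for a x :: real
  have int: "integrable lborel (h a)" and val: "(LINT x|lborel. h a x) = 2 * pi * \<bar>a\<bar> * fejer_mass" for a
    using integrable_fejer_scaled[of "2 * pi * a"] integral_fejer_scaled[of "2 * pi * a"]
    unfolding h_def by (auto simp: abs_mult)
  have e: "fejer \<delta> x * cos (2 * pi * \<xi> * x) = (h (\<xi> + \<delta>) x + h (\<xi> - \<delta>) x) / 2 - h \<xi> x" for x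
  proof -
    have "2 * pi * (\<xi> + \<delta>) * x = 2 * pi * \<xi> * x + 2 * pi * \<delta> * x"
      "2 * pi * (\<xi> - \<delta>) * x = 2 * pi * \<xi> * x - 2 * pi * \<delta> * x" by (simp_all add: algebra_simps)
    then show ?thesis unfolding fejer_def h_def
      by (simp only: cos_add cos_diff) (simp add: divide_simps, simp add: algebra_simps)
  qed
  have "(LINT x|lborel. fejer \<delta> x * cos (2 * pi * \<xi> * x))
     = (2 * pi * \<bar>\<xi> + \<delta>\<bar> * fejer_mass + 2 * pi * \<bar>\<xi> - \<delta>\<bar> * fejer_mass) / 2 - 2 * pi * \<bar>\<xi>\<bar> * fejer_mass"
    unfolding e using int by (simp add: val)
  also have "\<dots> = pi * fejer_mass * (\<bar>\<xi> + \<delta>\<bar> + \<bar>\<xi> - \<delta>\<bar> - 2 * \<bar>\<xi>\<bar>)"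
    by (simp add: algebra_simps)
  also have "\<bar>\<xi> + \<delta>\<bar> + \<bar>\<xi> - \<delta>\<bar> - 2 * \<bar>\<xi>\<bar> = 2 * max 0 (\<delta> - \<bar>\<xi>\<bar>)"
    using assms by (auto simp: max_def abs_if)
  finally show ?thesis by (simp add: fejer_hat_def)
qed

lemma fejer_fourier:
  assumes "0 < \<delta>"
  shows "(LINT x|lborel. complex_of_real (fejer \<delta> x) * cis (- 2 * pi * \<xi> * x)) = complex_of_real (fejer_hat \<delta> \<xi>)"
proof (rule complex_eqI)
  let ?f = "\<lambda>x. complex_of_real (fejer \<delta> x) * cis (- 2 * pi * \<xi> * x)"
  have int: "integrable lborel ?f" using integrable_fejer_cis[of \<delta> "- 2 * pi * \<xi>"] by simp
  have "Re (LINT x|lborel. ?f x) = (LINT x|lborel. Re (?f x))"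
    by (rule integral_Re[OF int, symmetric])
  then show "Re (LINT x|lborel. ?f x) = Re (complex_of_real (fejer_hat \<delta> \<xi>))"
    using fejer_cos_integral[OF assms, of \<xi>] by simp
  have "Im (LINT x|lborel. ?f x) = (LINT x|lborel. Im (?f x))"
    by (rule integral_Im[OF int, symmetric])
  \<comment> \<open>The imaginary part is odd.\<close>
  moreover have "(LINT x|lborel. Im (?f x)) = - (LINT x|lborel. Im (?f x))"
  proof -
    have "(LINT x|lborel. Im (?f x)) = (LINT x|lborel. Im (?f (0 + (-1) * x)))"
      using lborel_integral_real_affine[of "-1" "\<lambda>x. Im (?f x)" 0] by simp
    also have "\<dots> = (LINT x|lborel. - Im (?f x))"
      by (intro Bochner_Integration.integral_cong refl) (simp add: fejer_def)
    finally show ?thesis by (simp only: integral_minus)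
  qed
  ultimately have "Im (LINT x|lborel. ?f x) = 0" by linarith
  then show "Im (LINT x|lborel. ?f x) = Im (complex_of_real (fejer_hat \<delta> \<xi>))"
    by (simp only: Im_complex_of_real)
qed

text \<open>
  A majorant of the squared Fejer kernel, up to a constant, that varies slowly at unit scale.
\<close>

definition cauchy_kernel :: "real \<Rightarrow> real \<Rightarrow> real" where
  "cauchy_kernel \<delta> x = 1 / (1 + (\<delta> * x)\<^sup>2)"

lemma measurable_cauchy_kernel [measurable]: "cauchy_kernel \<delta> \<in> borel_measurable borel"
  unfolding cauchy_kernel_def[abs_def] by measurable

lemma cauchy_kernel_nonneg: "0 \<le> cauchy_kernel \<delta> x"
  by (simp add: cauchy_kernel_def)

lemma nn_integral_cauchy_kernel:
  assumes "0 < \<delta>"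
  shows "(\<integral>\<^sup>+x. ennreal (cauchy_kernel \<delta> x) \<partial>lborel) = ennreal (pi / \<delta>)"
proof -
  have "integrable lborel (cauchy_kernel \<delta>)"
    using lborel_integrable_real_affine[OF integrable_cauchy, of \<delta> 0] assms
    by (simp add: cauchy_kernel_def[abs_def])
  moreover have "(LINT x|lborel. cauchy_kernel \<delta> x) = pi / \<delta>"
    using lborel_integral_real_affine[of \<delta> "\<lambda>x. 1 / (1 + x\<^sup>2)" 0] assms
    by (simp add: cauchy_kernel_def integral_cauchy field_simps)
  ultimately show ?thesis
    by (subst nn_integral_eq_integral) (auto simp: cauchy_kernel_nonneg)
qed

lemma fejer_square_le:
  "(fejer \<delta> x)\<^sup>2 \<le> 256 * pi ^ 4 * \<delta> ^ 4 * cauchy_kernel \<delta> x"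
proof (cases "\<delta> * x = 0")
  case True
  then show ?thesis by (auto simp: fejer_def cauchy_kernel_def)
next
  case False
  let ?y = "2 * pi * \<delta> * x"
  have "fejer \<delta> x = (2 * pi * \<delta>)\<^sup>2 * ((1 - cos ?y) / ?y\<^sup>2)"
    using False by (simp add: fejer_def power_mult_distrib)
  also have "\<dots> \<le> (2 * pi * \<delta>)\<^sup>2 * (4 / (1 + ?y\<^sup>2))"
    by (intro mult_left_mono one_minus_cos_div_le) simp
  also have "\<dots> \<le> (2 * pi * \<delta>)\<^sup>2 * (4 * cauchy_kernel \<delta> x)"
  proof -
    have "1 \<le> (2 * pi)\<^sup>2" using pi_gt3 by (intro one_le_power) simp
    then have "1 * (\<delta> * x)\<^sup>2 \<le> (2 * pi)\<^sup>2 * (\<delta> * x)\<^sup>2" by (intro mult_right_mono) auto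
    then have "1 + (\<delta> * x)\<^sup>2 \<le> 1 + ?y\<^sup>2" by (simp add: power_mult_distrib mult_ac)
    then have "4 / (1 + ?y\<^sup>2) \<le> 4 / (1 + (\<delta> * x)\<^sup>2)"
      by (intro divide_left_mono mult_pos_pos add_pos_nonneg) auto
    then show ?thesis by (intro mult_left_mono) (auto simp: cauchy_kernel_def)
  qed
  also have "\<dots> = 16 * pi\<^sup>2 * \<delta>\<^sup>2 * cauchy_kernel \<delta> x"
    by (simp add: power_mult_distrib)
  finally have "(fejer \<delta> x)\<^sup>2 \<le> (16 * pi\<^sup>2 * \<delta>\<^sup>2 * cauchy_kernel \<delta> x)\<^sup>2"
    by (intro power_mono fejer_nonneg)
  also have "\<dots> = 256 * pi ^ 4 * \<delta> ^ 4 * (cauchy_kernel \<delta> x * cauchy_kernel \<delta> x)"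
    by (simp add: power_mult_distrib power2_eq_square mult_ac flip: power_mult power_add) (simp add: numeral_eq_Suc mult_ac)
  also have "\<dots> \<le> 256 * pi ^ 4 * \<delta> ^ 4 * (cauchy_kernel \<delta> x * 1)"
    by (intro mult_left_mono) (auto simp: cauchy_kernel_def divide_le_eq_1 add_pos_nonneg)
  finally show ?thesis by simp
qed

lemma cauchy_kernel_slowly_varying:
  assumes "\<bar>\<delta>\<bar> \<le> 1" "\<bar>s\<bar> \<le> 1"
  shows "cauchy_kernel \<delta> x \<le> 3 * cauchy_kernel \<delta> (s + x)"
proof -
  have "\<bar>\<delta> * s\<bar> \<le> 1 * 1" unfolding abs_mult using assms by (intro mult_mono) auto
  then have "(\<delta> * s)\<^sup>2 \<le> 1" by (simp add: abs_square_le_1)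
  moreover have "(\<delta> * (s + x))\<^sup>2 \<le> 2 * (\<delta> * s)\<^sup>2 + 2 * (\<delta> * x)\<^sup>2"
  proof -
    have "(\<delta> * (s + x))\<^sup>2 = 2 * (\<delta> * s)\<^sup>2 + 2 * (\<delta> * x)\<^sup>2 - (\<delta> * s - \<delta> * x)\<^sup>2"
      by (simp add: power2_eq_square algebra_simps)
    then show ?thesis by simp
  qed
  moreover have "0 \<le> (\<delta> * x)\<^sup>2" by simp
  ultimately have le: "1 + (\<delta> * (s + x))\<^sup>2 \<le> 3 * (1 + (\<delta> * x)\<^sup>2)"
    unfolding distrib_left by linarith
  have pos: "0 < 1 + (\<delta> * (s + x))\<^sup>2" "0 < 1 + (\<delta> * x)\<^sup>2" by (auto intro: add_pos_nonneg)
  have "1 / (1 + (\<delta> * x)\<^sup>2) \<le> 3 / (1 + (\<delta> * (s + x))\<^sup>2)"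
  proof -
    have "1 / b \<le> 3 / a" if "a \<le> 3 * b" "0 < a" "0 < b" for a b :: real
      using that by (simp add: field_simps)
    then show ?thesis using le pos by blast
  qed
  then show ?thesis by (simp add: cauchy_kernel_def)
qed

definition line_sum :: "nat \<Rightarrow> real \<Rightarrow> complex" where
  "line_sum n x = (\<Sum>i<n. cis (2 * pi * 8 ^ i * x))"

lemma continuous_line_sum [continuous_intros]:
  "continuous_on S f \<Longrightarrow> continuous_on S (\<lambda>x. line_sum n (f x))"
  unfolding line_sum_def by (intro continuous_intros)

lemma measurable_line_sum [measurable]: "line_sum n \<in> borel_measurable borel"
  by (intro borel_measurable_continuous_onI continuous_intros)

lemma line_sum_mean: "(\<integral>\<^sup>+s\<in>{0..1}. ennreal ((norm (line_sum n (y - s)))\<^sup>2) \<partial>lborel) = ennreal n"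
proof (rule nn_integral_has_integral_Icc)
  show "((\<lambda>s. (norm (line_sum n (y - s)))\<^sup>2) has_integral real n) {0..1}"
    using orthogonality_sum_cis[of "\<lambda>i. - (8 ^ i)" n "\<lambda>i. 2 * pi * 8 ^ i * y"]
    by (simp add: line_sum_def inj_on_def algebra_simps)
qed (auto intro!: continuous_intros)

text \<open>
  The norm of the datum is bounded on the physical side: because the kernel is comparable to its translates by
  \<open>s \<in> {0..1}\<close>, the sum can be averaged over such translates, and by orthogonality its mean square
  over a unit interval is \<open>n\<close>.
\<close>

lemma weighted_line_sum:
  assumes "0 < \<delta>" "\<delta> \<le> 1"
  shows "(\<integral>\<^sup>+x. ennreal (cauchy_kernel \<delta> x) * ennreal ((norm (line_sum n x))\<^sup>2) \<partial>lborel)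
      \<le> ennreal (3 * real n * pi / \<delta>)"
proof -
  let ?p = "\<lambda>x. ennreal (cauchy_kernel \<delta> x)" and ?V = "\<lambda>x. ennreal ((norm (line_sum n x))\<^sup>2)"
  \<comment> \<open>A dummy average over \<open>s\<close>; for each \<open>s\<close> the kernel is then shifted by \<open>s\<close> and the variable renamed.\<close>
  have "(\<integral>\<^sup>+x. ?p x * ?V x \<partial>lborel) = (\<integral>\<^sup>+s. (\<integral>\<^sup>+x. ?p x * ?V x \<partial>lborel) * indicator {0..1} s \<partial>(lborel :: real measure))"
    by (subst nn_integral_cmult) auto
  also have "\<dots> \<le> (\<integral>\<^sup>+s. (\<integral>\<^sup>+y. 3 * ?p y * ?V (y - s) * indicator {0..1} s \<partial>lborel) \<partial>lborel)"
  proof (intro nn_integral_mono)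
    fix s :: real
    show "(\<integral>\<^sup>+x. ?p x * ?V x \<partial>lborel) * indicator {0..1} s
        \<le> (\<integral>\<^sup>+y. 3 * ?p y * ?V (y - s) * indicator {0..1} s \<partial>lborel)"
    proof (cases "s \<in> {0..1}")
      case True
      have "(\<integral>\<^sup>+x. ?p x * ?V x \<partial>lborel) \<le> (\<integral>\<^sup>+x. 3 * ?p (s + 1 * x) * ?V ((s + 1 * x) - s) \<partial>lborel)"
      proof (intro nn_integral_mono)
        fix x
        have "?p x \<le> ennreal (3 * cauchy_kernel \<delta> (s + x))"
          using assms True by (intro ennreal_leI cauchy_kernel_slowly_varying) auto
        then show "?p x * ?V x \<le> 3 * ?p (s + 1 * x) * ?V ((s + 1 * x) - s)"
          by (auto intro!: mult_right_mono simp: ennreal_mult cauchy_kernel_nonneg)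
      qed
      also have "\<dots> = (\<integral>\<^sup>+y. 3 * ?p y * ?V (y - s) \<partial>lborel)"
        using nn_integral_real_affine[of "\<lambda>y. 3 * ?p y * ?V (y - s)" 1 s] by simp
      finally show ?thesis using True by simp
    qed simp
  qed
  also have "\<dots> = (\<integral>\<^sup>+y. (\<integral>\<^sup>+s. 3 * ?p y * ?V (y - s) * indicator {0..1} s \<partial>lborel) \<partial>lborel)"
    by (rule lborel_pair.Fubini') measurable
  also have "\<dots> = (\<integral>\<^sup>+y. 3 * ?p y * ennreal n \<partial>lborel)"
    by (intro nn_integral_cong) (simp add: mult.assoc nn_integral_cmult line_sum_mean)
  also have "\<dots> = 3 * ennreal (pi / \<delta>) * ennreal n"
    by (simp add: nn_integral_cmult nn_integral_multc nn_integral_cauchy_kernel[OF assms(1)])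
  also have "\<dots> = ennreal (3 * real n * pi / \<delta>)"
    using assms by (simp flip: ennreal_mult ennreal_numeral add: mult_ac)
  finally show ?thesis .
qed

text \<open>
  The torus datum cut off by Fejer kernels of length \<open>1 / \<delta>\<close> in both variables. Its Fourier transform
  consists of \<open>n\<close> nonnegative bumps of width \<open>\<delta>\<close> around the frequencies \<open>(8 ^ i, 0)\<close>.
\<close>

definition datum :: "nat \<Rightarrow> real \<Rightarrow> real^2 \<Rightarrow> complex" where
  "datum n \<delta> x = complex_of_real (fejer \<delta> (x $ 1)) * line_sum n (x $ 1) * complex_of_real (fejer \<delta> (x $ 2))"

definition bump :: "nat \<Rightarrow> real \<Rightarrow> real^2 \<Rightarrow> real" where
  "bump i \<delta> \<xi> = fejer_hat \<delta> (\<xi> $ 1 - 8 ^ i) * fejer_hat \<delta> (\<xi> $ 2)"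

definition datum_ft :: "nat \<Rightarrow> real \<Rightarrow> real^2 \<Rightarrow> complex" where
  "datum_ft n \<delta> \<xi> = complex_of_real (\<Sum>i<n. bump i \<delta> \<xi>)"

lemma integrable_fejer_line_sum:
  "integrable lborel (\<lambda>x. complex_of_real (fejer \<delta> x) * line_sum n x)"
  unfolding line_sum_def sum_distrib_left
  by (intro Bochner_Integration.integrable_sum integrable_fejer_cis)

lemma integrable_datum: "integrable lborel (datum n \<delta>)"
  unfolding datum_def[abs_def]
  by (rule integrable_lborel_2_prod) (auto intro!: integrable_fejer_line_sum integrable_of_real integrable_fejer)

lemma fourier_integral_datum:
  assumes "0 < \<delta>"
  shows "fourier_integral (datum n \<delta>) \<xi> = datum_ft n \<delta> \<xi>"
proof -
  let ?h = "\<lambda>b x. complex_of_real (fejer \<delta> x) * cis (- 2 * pi * b * x)"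
  have int: "integrable lborel (?h b)" for b
    using integrable_fejer_cis[of \<delta> "- 2 * pi * b"] by simp
  have "fourier_integral (datum n \<delta>) \<xi> = (LINT x|(lborel :: (real^2) measure). (\<Sum>i<n. ?h (\<xi> $ 1 - 8 ^ i) (x $ 1) * ?h (\<xi> $ 2) (x $ 2)))"
    unfolding fourier_integral_def
  proof (intro Bochner_Integration.integral_cong refl)
    fix x :: "real^2"
    have "cis (2 * pi * 8 ^ i * x $ 1) * cis (- 2 * pi * (x \<bullet> \<xi>))
      = cis (- 2 * pi * (\<xi> $ 1 - 8 ^ i) * x $ 1) * cis (- 2 * pi * \<xi> $ 2 * x $ 2)" for i
      by (simp add: cis_mult inner_2 algebra_simps)
    then show "datum n \<delta> x * cis (- 2 * pi * (x \<bullet> \<xi>)) = (\<Sum>i<n. ?h (\<xi> $ 1 - 8 ^ i) (x $ 1) * ?h (\<xi> $ 2) (x $ 2))"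
      by (simp add: datum_def line_sum_def sum_distrib_left sum_distrib_right mult_ac)
  qed
  also have "\<dots> = (\<Sum>i<n. (LINT x|(lborel :: (real^2) measure). ?h (\<xi> $ 1 - 8 ^ i) (x $ 1) * ?h (\<xi> $ 2) (x $ 2)))"
    by (intro Bochner_Integration.integral_sum integrable_lborel_2_prod int)
  also have "\<dots> = datum_ft n \<delta> \<xi>"
    unfolding integral_lborel_2_prod[OF int int] fejer_fourier[OF assms]
    by (simp add: datum_ft_def bump_def)
  finally show ?thesis .
qed

text \<open>
  Both this bound and the one for the transform are of order \<open>n * \<delta> ^ 6\<close>, the size of \<open>n\<close> disjoint bumps
  of height \<open>\<delta>\<^sup>2\<close> over squares of area \<open>\<delta>\<^sup>2\<close>.
\<close>

lemma L2_norm_datum: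
  assumes "0 < \<delta>" "\<delta> \<le> 1"
  shows "L2_norm_sq UNIV (datum n \<delta>) \<le> ennreal (3 * 256\<^sup>2 * pi ^ 10 * n * \<delta> ^ 6)"
proof -
  let ?Q = "256 * pi ^ 4 * \<delta> ^ 4"
  have Q: "0 \<le> ?Q" using assms by simp
  have le: "ennreal ((fejer \<delta> x)\<^sup>2) \<le> ennreal ?Q * ennreal (cauchy_kernel \<delta> x)" for x
    unfolding ennreal_mult[OF Q cauchy_kernel_nonneg, symmetric] by (intro ennreal_leI fejer_square_le)
  have "L2_norm_sq UNIV (datum n \<delta>) =
    (\<integral>\<^sup>+x. (ennreal ((fejer \<delta> (x$1))\<^sup>2) * ennreal ((norm (line_sum n (x$1)))\<^sup>2)) * ennreal ((fejer \<delta> (x$2))\<^sup>2) \<partial>(lborel :: (real^2) measure))"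
    unfolding L2_norm_sq_def
    by (intro nn_integral_cong) (simp add: datum_def norm_mult power_mult_distrib fejer_nonneg flip: ennreal_mult)
  also have "\<dots> = (\<integral>\<^sup>+x. ennreal ((fejer \<delta> x)\<^sup>2) * ennreal ((norm (line_sum n x))\<^sup>2) \<partial>lborel)
     * (\<integral>\<^sup>+x. ennreal ((fejer \<delta> x)\<^sup>2) \<partial>lborel)"
    by (subst nn_integral_lborel_2_prod) auto
  also have "\<dots> \<le> (\<integral>\<^sup>+x. ennreal ?Q * (ennreal (cauchy_kernel \<delta> x) * ennreal ((norm (line_sum n x))\<^sup>2)) \<partial>lborel)
     * (\<integral>\<^sup>+x. ennreal ?Q * ennreal (cauchy_kernel \<delta> x) \<partial>lborel)"
    unfolding mult.assoc[symmetric] by (intro mult_mono nn_integral_mono mult_right_mono le) auto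
  also have "\<dots> = (ennreal ?Q * (\<integral>\<^sup>+x. ennreal (cauchy_kernel \<delta> x) * ennreal ((norm (line_sum n x))\<^sup>2) \<partial>lborel))
     * (ennreal ?Q * ennreal (pi / \<delta>))"
    by (simp add: nn_integral_cmult nn_integral_cauchy_kernel[OF assms(1)])
  also have "\<dots> \<le> (ennreal ?Q * ennreal (3 * real n * pi / \<delta>)) * (ennreal ?Q * ennreal (pi / \<delta>))"
    by (intro mult_mono weighted_line_sum assms) auto
  also have "\<dots> = ennreal ((?Q * (3 * real n * pi / \<delta>)) * (?Q * (pi / \<delta>)))"
  proof -
    have "ennreal q * ennreal a * (ennreal q * ennreal b) = ennreal (q * a * (q * b))"
      if "0 \<le> q" "0 \<le> a" "0 \<le> b" for q a b
      using that by (simp add: ennreal_mult)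
    then show ?thesis using assms by auto
  qed
  also have "(?Q * (3 * real n * pi / \<delta>)) * (?Q * (pi / \<delta>)) = 3 * 256\<^sup>2 * pi ^ 10 * n * \<delta> ^ 6"
    using assms by (simp add: field_simps numeral_eq_Suc)
  finally show ?thesis .
qed

lemma fejer_hat_nonneg: "0 \<le> fejer_hat \<delta> \<xi>" and fejer_hat_le: "0 < \<delta> \<Longrightarrow> fejer_hat \<delta> \<xi> \<le> 2 * pi * fejer_mass * \<delta>"
  and fejer_hat_eq_0: "\<delta> \<le> \<bar>\<xi>\<bar> \<Longrightarrow> fejer_hat \<delta> \<xi> = 0"
  using fejer_mass_pos by (auto simp: fejer_hat_def intro!: mult_nonneg_nonneg mult_left_mono)

lemma continuous_fejer_hat [continuous_intros]: "continuous_on S f \<Longrightarrow> continuous_on S (\<lambda>x. fejer_hat \<delta> (f x))"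
  unfolding fejer_hat_def by (intro continuous_intros)

lemma measurable_fejer_hat [measurable]: "fejer_hat \<delta> \<in> borel_measurable borel"
  by (intro borel_measurable_continuous_onI continuous_intros)

lemma measurable_bump [measurable]: "bump i \<delta> \<in> borel_measurable borel"
  unfolding bump_def[abs_def] by measurable

lemma measurable_datum_ft [measurable]: "datum_ft n \<delta> \<in> borel_measurable borel"
  unfolding datum_ft_def[abs_def] by measurable

text \<open>
  For \<open>\<delta> \<le> 1 / 2\<close> no point lies in the interior of two of the intervals around the integers \<open>8 ^ i\<close>,
  so at most one term of the sum is nonzero.
\<close>

lemma sum_fejer_hat_square_le:
  assumes "0 < \<delta>" "\<delta> \<le> 1 / 2"
  shows "(\<Sum>i<n. fejer_hat \<delta> (a - 8 ^ i))\<^sup>2 \<le> (\<Sum>i<n. (2 * pi * fejer_mass * \<delta>)\<^sup>2 * indicator {8 ^ i - \<delta>..8 ^ i + \<delta>} a)"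
proof (cases "\<exists>i<n. \<bar>a - 8 ^ i\<bar> < \<delta>")
  case False
  then have "(\<Sum>i<n. fejer_hat \<delta> (a - 8 ^ i)) = 0"
    by (intro sum.neutral ballI fejer_hat_eq_0) (meson lessThan_iff not_less)
  then show ?thesis by (auto intro!: sum_nonneg)
next
  case True
  then obtain j where j: "j < n" "\<bar>a - 8 ^ j\<bar> < \<delta>" by auto
  have "fejer_hat \<delta> (a - 8 ^ i) = 0" if "i \<noteq> j" for i
  proof (rule fejer_hat_eq_0, rule ccontr)
    assume "\<not> \<delta> \<le> \<bar>a - 8 ^ i\<bar>"
    then have "\<bar>(8::real) ^ i - 8 ^ j\<bar> < 1" using j assms by linarith
    then have "\<bar>real_of_int (8 ^ i - 8 ^ j)\<bar> < 1" by simp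
    then have "\<bar>(8::int) ^ i - 8 ^ j\<bar> < 1" by (simp only: flip: of_int_abs)
    then have "(8::int) ^ i = 8 ^ j" by linarith
    then show False using that by simp
  qed
  then have "(\<Sum>i<n. fejer_hat \<delta> (a - 8 ^ i)) = (\<Sum>i<n. if i = j then fejer_hat \<delta> (a - 8 ^ j) else 0)"
    by (intro sum.cong) auto
  also have "\<dots> = fejer_hat \<delta> (a - 8 ^ j)" using j by simp
  finally have "(\<Sum>i<n. fejer_hat \<delta> (a - 8 ^ i))\<^sup>2 \<le> (2 * pi * fejer_mass * \<delta>)\<^sup>2"
    using fejer_hat_le[OF assms(1)] by (simp add: power_mono fejer_hat_nonneg)
  also have "\<dots> = (2 * pi * fejer_mass * \<delta>)\<^sup>2 * indicator {8 ^ j - \<delta>..8 ^ j + \<delta>} a"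
    using j by (auto simp: indicator_def)
  also have "\<dots> \<le> (\<Sum>i<n. (2 * pi * fejer_mass * \<delta>)\<^sup>2 * indicator {8 ^ i - \<delta>..8 ^ i + \<delta>} a)"
    using j by (intro member_le_sum) auto
  finally show ?thesis .
qed

lemma L2_norm_datum_ft:
  assumes "0 < \<delta>" "\<delta> \<le> 1 / 2"
  shows "L2_norm_sq UNIV (datum_ft n \<delta>) \<le> ennreal (4 * real n * (2 * pi * fejer_mass) ^ 4 * \<delta> ^ 6)"
proof -
  let ?T = "2 * pi * fejer_mass * \<delta>"
  have T: "0 \<le> ?T" using assms fejer_mass_pos by simp
  have "L2_norm_sq UNIV (datum_ft n \<delta>) \<le> (\<integral>\<^sup>+\<xi>. ennreal (\<Sum>i<n. ?T\<^sup>2 * indicator {8 ^ i - \<delta>..8 ^ i + \<delta>} (\<xi> $ 1))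
        * ennreal (?T\<^sup>2 * indicator {- \<delta>..\<delta>} (\<xi> $ 2)) \<partial>(lborel :: (real^2) measure))"
    unfolding L2_norm_sq_def
  proof (intro nn_integral_mono)
    fix \<xi> :: "real^2"
    have "fejer_hat \<delta> (\<xi> $ 2) ^ 2 \<le> ?T\<^sup>2 * indicator {- \<delta>..\<delta>} (\<xi> $ 2)"
      using fejer_hat_le[OF assms(1), of "\<xi> $ 2"] fejer_hat_nonneg[of \<delta> "\<xi> $ 2"] fejer_hat_eq_0[of \<delta> "\<xi> $ 2"]
      by (cases "\<delta> \<le> \<bar>\<xi> $ 2\<bar>") (auto simp: indicator_def power_mono)
    then have "(\<Sum>i<n. fejer_hat \<delta> (\<xi> $ 1 - 8 ^ i))\<^sup>2 * fejer_hat \<delta> (\<xi> $ 2) ^ 2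
      \<le> (\<Sum>i<n. ?T\<^sup>2 * indicator {8 ^ i - \<delta>..8 ^ i + \<delta>} (\<xi> $ 1)) * (?T\<^sup>2 * indicator {- \<delta>..\<delta>} (\<xi> $ 2))"
      by (intro mult_mono sum_fejer_hat_square_le assms) (auto intro!: sum_nonneg)
    moreover have "(norm (datum_ft n \<delta> \<xi>))\<^sup>2 = (\<Sum>i<n. fejer_hat \<delta> (\<xi> $ 1 - 8 ^ i))\<^sup>2 * fejer_hat \<delta> (\<xi> $ 2) ^ 2"
      by (simp add: datum_ft_def bump_def flip: sum_distrib_right of_real_mult power_mult_distrib del: of_real_sum)
    ultimately have "(norm (datum_ft n \<delta> \<xi>))\<^sup>2 \<le> (\<Sum>i<n. ?T\<^sup>2 * indicator {8 ^ i - \<delta>..8 ^ i + \<delta>} (\<xi> $ 1)) * (?T\<^sup>2 * indicator {- \<delta>..\<delta>} (\<xi> $ 2))"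
      by simp
    then show "ennreal ((norm (datum_ft n \<delta> \<xi>))\<^sup>2) * indicator UNIV \<xi> \<le> ennreal (\<Sum>i<n. ?T\<^sup>2 * indicator {8 ^ i - \<delta>..8 ^ i + \<delta>} (\<xi> $ 1))
        * ennreal (?T\<^sup>2 * indicator {- \<delta>..\<delta>} (\<xi> $ 2))"
      by (subst ennreal_mult[symmetric]) (auto intro!: sum_nonneg ennreal_leI)
  qed
  also have "\<dots> = (\<integral>\<^sup>+a. ennreal (\<Sum>i<n. ?T\<^sup>2 * indicator {8 ^ i - \<delta>..8 ^ i + \<delta>} a) \<partial>lborel)
        * (\<integral>\<^sup>+a. ennreal (?T\<^sup>2 * indicator {- \<delta>..\<delta>} a) \<partial>lborel)"
    by (subst nn_integral_lborel_2_prod) auto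
  also have "(\<integral>\<^sup>+a. ennreal (?T\<^sup>2 * indicator {- \<delta>..\<delta>} a) \<partial>lborel) = ennreal (?T\<^sup>2 * (2 * \<delta>))"
    using assms by (simp add: ennreal_mult nn_integral_cmult ennreal_indicator)
  also have "(\<integral>\<^sup>+a. ennreal (\<Sum>i<n. ?T\<^sup>2 * indicator {8 ^ i - \<delta>..8 ^ i + \<delta>} a) \<partial>lborel) = ennreal (n * (?T\<^sup>2 * (2 * \<delta>)))"
  proof -
    have "(\<integral>\<^sup>+a. ennreal (\<Sum>i<n. ?T\<^sup>2 * indicator {8 ^ i - \<delta>..8 ^ i + \<delta>} a) \<partial>lborel)
        = (\<integral>\<^sup>+a. (\<Sum>i<n. ennreal (?T\<^sup>2) * indicator {8 ^ i - \<delta>..8 ^ i + \<delta>} a) \<partial>lborel)"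
      by (intro nn_integral_cong, subst sum_ennreal[symmetric]) (auto simp: ennreal_mult ennreal_indicator)
    also have "\<dots> = (\<Sum>i<n. ennreal (?T\<^sup>2) * ennreal (2 * \<delta>))"
      using assms by (subst nn_integral_sum) (auto simp: nn_integral_cmult)
    also have "\<dots> = ennreal (n * (?T\<^sup>2 * (2 * \<delta>)))"
      using assms by (simp add: ennreal_mult ennreal_of_nat_eq_real_of_nat)
    finally show ?thesis .
  qed
  also have "ennreal (n * (?T\<^sup>2 * (2 * \<delta>))) * ennreal (?T\<^sup>2 * (2 * \<delta>)) = ennreal (4 * real n * (2 * pi * fejer_mass) ^ 4 * \<delta> ^ 6)"
    using assms by (simp flip: ennreal_mult) (simp add: power_mult_distrib numeral_eq_Suc mult_ac)
  finally show ?thesis .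
qed

lemma fourier_L2_datum:
  assumes "0 < \<delta>" "\<delta> \<le> 1 / 2"
  shows "fourier_L2 (datum n \<delta>) (datum_ft n \<delta>)"
proof -
  have "in_L2 (datum n \<delta>)"
    using le_less_trans[OF L2_norm_datum[of \<delta> n] ennreal_less_top] assms
      borel_measurable_integrable[OF integrable_datum]
    by (auto simp: in_L2_def)
  moreover have "in_L2 (datum_ft n \<delta>)"
    using le_less_trans[OF L2_norm_datum_ft[OF assms, of n] ennreal_less_top] by (auto simp: in_L2_def)
  moreover have "L2_norm_sq UNIV (\<lambda>x :: real^2. 0) = 0" by (simp add: L2_norm_sq_def)
  ultimately show ?thesis
    unfolding fourier_L2_def using assms
    by (auto intro!: exI[of _ "\<lambda>_. datum n \<delta>"] integrable_datum simp: fourier_integral_datum)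
qed

section \<open>Lower bounds in Euclidean space\<close>

lemma abs_cos_diff_le: "\<bar>cos a - cos b\<bar> \<le> \<bar>a - b\<bar>" for a b :: real
proof -
  have "\<bar>cos a - cos b\<bar> = 2 * (\<bar>sin ((a + b) / 2)\<bar> * \<bar>sin ((b - a) / 2)\<bar>)"
    by (simp add: cos_diff_cos abs_mult)
  also have "\<dots> \<le> 2 * (1 * \<bar>(b - a) / 2\<bar>)"
    by (intro mult_left_mono mult_mono abs_sin_x_le_abs_x abs_sin_le_one) auto
  finally show ?thesis by simp
qed

lemma riesz_lipschitz: "\<bar>riesz n \<alpha> - riesz n \<beta>\<bar> \<le> 2 ^ n * (\<Sum>i<n. \<bar>\<alpha> i - \<beta> i\<bar>)"
proof -
  have half: "riesz n \<gamma> = 2 ^ n * (\<Prod>i<n. (1 + cos (\<gamma> i)) / 2)" for \<gamma>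
    by (simp add: riesz_def prod_dividef)
  have le1: "norm ((1 + cos (\<gamma> i)) / 2) \<le> 1" for \<gamma> :: "nat \<Rightarrow> real" and i
  proof -
    have "0 \<le> 1 + cos (\<gamma> i)" using cos_ge_minus_one[of "\<gamma> i"] by linarith
    then show ?thesis by simp
  qed
  have "\<bar>(\<Prod>i<n. (1 + cos (\<alpha> i)) / 2) - (\<Prod>i<n. (1 + cos (\<beta> i)) / 2)\<bar>
      \<le> (\<Sum>i<n. \<bar>(1 + cos (\<alpha> i)) / 2 - (1 + cos (\<beta> i)) / 2\<bar>)"
    using norm_prod_diff[of "{..<n}", OF le1 le1] by simp
  also have "\<dots> \<le> (\<Sum>i<n. \<bar>\<alpha> i - \<beta> i\<bar>)"
  proof (rule sum_mono)
    fix i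
    have "\<bar>(1 + cos (\<alpha> i)) / 2 - (1 + cos (\<beta> i)) / 2\<bar> = \<bar>cos (\<alpha> i) - cos (\<beta> i)\<bar> / 2"
      by (simp flip: diff_divide_distrib)
    also have "\<dots> \<le> \<bar>cos (\<alpha> i) - cos (\<beta> i)\<bar>" by simp
    also have "\<dots> \<le> \<bar>\<alpha> i - \<beta> i\<bar>" by (rule abs_cos_diff_le)
    finally show "\<bar>(1 + cos (\<alpha> i)) / 2 - (1 + cos (\<beta> i)) / 2\<bar> \<le> \<bar>\<alpha> i - \<beta> i\<bar>" .
  qed
  finally have "2 ^ n * \<bar>(\<Prod>i<n. (1 + cos (\<alpha> i)) / 2) - (\<Prod>i<n. (1 + cos (\<beta> i)) / 2)\<bar>
      \<le> 2 ^ n * (\<Sum>i<n. \<bar>\<alpha> i - \<beta> i\<bar>)" by (intro mult_left_mono) auto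
  then show ?thesis unfolding half right_diff_distrib[symmetric] abs_mult by simp
qed

text \<open>
  The periodic weight is cut off in time only, which makes the X-ray transform over the whole line finite;
  in space it may stay periodic, since the solution is square integrable there.
\<close>

definition strip_weight :: "nat \<Rightarrow> (real^2) \<times> real \<Rightarrow> real" where
  "strip_weight n z = indicator (UNIV \<times> {0..1}) z * riesz_weight n z"

lemma strip_weight_eq: "strip_weight n (x, t) = indicator {0..1} t * riesz n (\<lambda>i. phase i (x $ 1) t)"
  by (simp add: strip_weight_def riesz_weight_def indicator_def)

lemma weight_strip_weight: "weight (strip_weight n)"
proof -
  have strip [measurable]: "UNIV \<times> {0..1} \<in> sets (borel :: ((real^2) \<times> real) measure)"
    by (intro borel_closed closed_Times) auto
  have w [measurable]: "riesz_weight n \<in> borel_measurable borel"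
    by (intro borel_measurable_continuous_onI continuous_riesz_weight)
  have "set_integrable lborel K (strip_weight n)" if "compact K" for K
  proof -
    have "integrable lborel (\<lambda>z. indicator (UNIV \<times> {0..1}) z *\<^sub>R (indicator K z *\<^sub>R riesz_weight n z))"
      by (intro integrable_mult_indicator borel_integrable_compact that continuous_riesz_weight) simp
    then show ?thesis unfolding set_integrable_def strip_weight_def by (simp add: mult_ac)
  qed
  moreover have "strip_weight n \<in> borel_measurable borel"
    unfolding strip_weight_def[abs_def] by measurable
  moreover have "0 \<le> strip_weight n z" for z
    by (simp add: strip_weight_def riesz_weight_def riesz_nonneg)
  ultimately show ?thesis unfolding weight_def by blast
qed

text \<open>
  The factor \<open>16 ^ n\<close> is the product of \<open>2 ^ n\<close>, the maximum of the weight, and \<open>8 ^ n\<close>, a bound for its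
  spatial frequencies: at this width the X-ray transforms over a whole bump stay within \<open>1\<close> of those at
  its centre. The factor \<open>256\<close> keeps the phase errors on a square of side \<open>16 ^ n\<close> below \<open>1 / 8\<close>.
\<close>

definition width :: "nat \<Rightarrow> real" where
  "width n = 1 / (256 * 16 ^ n)"

lemma width_pos: "0 < width n" and width_le: "width n \<le> 1 / 256"
  by (simp_all add: width_def divide_simps)

definition tubes :: "nat \<Rightarrow> (real^2) set" where
  "tubes n = {v. \<bar>v $ 2\<bar> \<le> width n \<and> (\<exists>i<n. \<bar>v $ 1 - 8 ^ i\<bar> \<le> width n)}"

lemma sum_pow8_le: "(\<Sum>i<n. (8::real) ^ i) \<le> 8 ^ n"
proof (induction n)
  case (Suc n)
  moreover have "(0::real) \<le> 8 ^ n" by simp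
  ultimately show ?case unfolding sum.lessThan_Suc power_Suc by linarith
qed simp

text \<open>
  Moving the direction from \<open>8 ^ j\<close> by at most \<open>width n\<close> changes the weight on the line by at most \<open>1\<close>,
  so its mean stays below \<open>1 + 1\<close>.
\<close>

lemma xray_strip_le:
  assumes "v \<in> tubes n"
  shows "xray_R (strip_weight n) x v \<le> 2"
proof -
  obtain j where j: "\<bar>v $ 1 - 8 ^ j\<bar> \<le> width n" using assms by (auto simp: tubes_def)
  have le: "riesz n (\<lambda>i. phase i (x $ 1 - 2 * t * v $ 1) t) \<le> riesz n (\<lambda>i. phase i (x $ 1 - 2 * t * 8 ^ j) t) + 1"
    if t: "t \<in> {0..1}" for t
  proof -
    have d: "\<bar>phase i (x $ 1 - 2 * t * v $ 1) t - phase i (x $ 1 - 2 * t * 8 ^ j) t\<bar> \<le> 4 * pi * width n * 8 ^ i" for i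
    proof -
      have "phase i (x $ 1 - 2 * t * v $ 1) t - phase i (x $ 1 - 2 * t * 8 ^ j) t
          = - (4 * pi * 8 ^ i * (t * (v $ 1 - 8 ^ j)))"
        by (simp add: phase_def algebra_simps)
      moreover have "\<bar>t * (v $ 1 - 8 ^ j)\<bar> \<le> 1 * width n"
        unfolding abs_mult using t j by (intro mult_mono) auto
      ultimately show ?thesis by (simp add: abs_mult)
    qed
    have "riesz n (\<lambda>i. phase i (x $ 1 - 2 * t * v $ 1) t) - riesz n (\<lambda>i. phase i (x $ 1 - 2 * t * 8 ^ j) t)
       \<le> 2 ^ n * (\<Sum>i<n. 4 * pi * width n * 8 ^ i)"
      by (rule order_trans[OF abs_ge_self order_trans[OF riesz_lipschitz]]) (intro mult_left_mono sum_mono d, simp)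
    also have "\<dots> \<le> 2 ^ n * (4 * pi * width n * 8 ^ n)"
      unfolding sum_distrib_left[symmetric]
      using width_pos[of n] by (intro mult_left_mono sum_pow8_le) auto
    also have "\<dots> = pi / 64 * ((2 * 8) ^ n / 16 ^ n)"
      unfolding width_def power_mult_distrib by (simp add: field_simps)
    also have "\<dots> \<le> 1" using pi_less_4 by simp
    finally show ?thesis by simp
  qed
  have "xray_R (strip_weight n) x v
     \<le> (\<integral>\<^sup>+t\<in>{0..1}. ennreal (riesz n (\<lambda>i. phase i (x $ 1 - 2 * t * 8 ^ j) t) + 1) \<partial>lborel)"
    unfolding xray_R_def strip_weight_eq
    using le by (intro nn_integral_mono) (auto simp: indicator_def intro!: ennreal_leI)
  also have "\<dots> = ennreal (1 + 1)"
  proof (rule nn_integral_has_integral_Icc)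
    show "((\<lambda>t. riesz n (\<lambda>i. phase i (x $ 1 - 2 * t * 8 ^ j) t) + 1) has_integral 1 + 1) {0..1}"
      using has_integral_const_real[of "1::real" 0 1] by (intro has_integral_add riesz_xray) simp
  qed (auto intro!: continuous_intros simp: riesz_nonneg add_nonneg_nonneg)
  finally show ?thesis by simp
qed

lemma datum_ft_eq_0:
  assumes "v \<notin> tubes n"
  shows "datum_ft n (width n) v = 0"
proof -
  have "bump i (width n) v = 0" if "i < n" for i
  proof (cases "width n \<le> \<bar>v $ 2\<bar>")
    case False
    then have "width n \<le> \<bar>v $ 1 - 8 ^ i\<bar>" using assms that by (fastforce simp: tubes_def)
    then show ?thesis by (simp add: bump_def fejer_hat_eq_0)
  qed (simp add: bump_def fejer_hat_eq_0)
  then show ?thesis by (simp add: datum_ft_def)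
qed

lemma closed_tubes: "closed (tubes n)"
proof -
  have "tubes n = (\<Union>i<n. {v. \<bar>v $ 2\<bar> \<le> width n} \<inter> {v. \<bar>v $ 1 - 8 ^ i\<bar> \<le> width n})"
    by (auto simp: tubes_def)
  also have "closed \<dots>"
    by (intro closed_UN ballI closed_Int closed_Collect_le continuous_intros) auto
  finally show ?thesis .
qed

lemma ess_support_datum_ft: "ess_support (datum_ft n (width n)) \<subseteq> tubes n"
proof (rule ccontr)
  assume "\<not> ?thesis"
  then obtain v where v: "v \<in> ess_support (datum_ft n (width n))" "v \<in> - tubes n" by auto
  moreover have "open (- tubes n)" using closed_tubes by (rule open_Compl)
  moreover have "AE x in lborel. x \<in> - tubes n \<longrightarrow> datum_ft n (width n) x = 0"
    by (intro AE_I2) (simp add: datum_ft_eq_0)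
  ultimately show False unfolding ess_support_def by blast
qed

lemma tubes_subset_box:
  assumes "8 ^ n \<le> N"
  shows "tubes n \<subseteq> box_R N"
proof
  fix v assume "v \<in> tubes n"
  then obtain i where i: "i < n" "\<bar>v $ 1 - 8 ^ i\<bar> \<le> width n" "\<bar>v $ 2\<bar> \<le> width n" by (auto simp: tubes_def)
  have "(8::real) * 8 ^ i \<le> 8 ^ n" using power_increasing[of "Suc i" n "8::real"] i by simp
  moreover have "(1::real) \<le> 8 ^ i" by simp
  ultimately have "\<bar>v $ 1\<bar> \<le> N" "\<bar>v $ 2\<bar> \<le> N"
    using i width_le[of n] assms by linarith+
  then show "v \<in> box_R N"
    by (simp add: box_R_def forall_2 abs_le_iff)
qed

lemma integrable_fejer_hat:
  assumes "0 < \<delta>"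
  shows "integrable lborel (fejer_hat \<delta>)"
proof (rule Bochner_Integration.integrable_bound)
  show "integrable lborel (\<lambda>x. 2 * pi * fejer_mass * \<delta> * indicat_real {- \<delta>..\<delta>} x)" using assms by simp
  show "AE x in lborel. norm (fejer_hat \<delta> x) \<le> norm (2 * pi * fejer_mass * \<delta> * indicat_real {- \<delta>..\<delta>} x)"
  proof (intro AE_I2)
    fix x
    show "norm (fejer_hat \<delta> x) \<le> norm (2 * pi * fejer_mass * \<delta> * indicat_real {- \<delta>..\<delta>} x)"
      using fejer_hat_le[OF assms, of x] fejer_hat_nonneg[of \<delta> x] fejer_hat_eq_0[of \<delta> x] 
      by (cases "\<delta> \<le> \<bar>x\<bar>") (auto simp: indicator_def)
  qed
qed simp

definition fejer_hat_mass :: "real \<Rightarrow> real" where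
  "fejer_hat_mass \<delta> = (LINT x|lborel. fejer_hat \<delta> x)"

lemma fejer_hat_mass_ge:
  assumes "0 < \<delta>"
  shows "pi * fejer_mass * \<delta>\<^sup>2 \<le> fejer_hat_mass \<delta>"
proof -
  have "pi * fejer_mass * \<delta>\<^sup>2 = (LINT x|lborel. pi * fejer_mass * \<delta> * indicat_real {- (\<delta> / 2)..\<delta> / 2} x)"
    using assms by (simp add: power2_eq_square)
  also have "\<dots> \<le> fejer_hat_mass \<delta>"
    unfolding fejer_hat_mass_def
  proof (rule integral_mono[OF _ integrable_fejer_hat[OF assms]])
    fix x
    show "pi * fejer_mass * \<delta> * indicat_real {- (\<delta> / 2)..\<delta> / 2} x \<le> fejer_hat \<delta> x"
    proof (cases "x \<in> {- (\<delta> / 2)..\<delta> / 2}")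
      case True
      then have "2 * pi * fejer_mass * (\<delta> / 2) \<le> fejer_hat \<delta> x"
        unfolding fejer_hat_def using fejer_mass_pos by (intro mult_left_mono) auto
      then show ?thesis using True by simp
    qed (simp add: fejer_hat_nonneg)
  qed (use assms in simp)
  finally show ?thesis .
qed

lemma
  assumes "0 < \<delta>"
  shows integrable_bump: "integrable lborel (bump i \<delta>)"
    and integral_bump: "(LINT \<xi>|lborel. bump i \<delta> \<xi>) = (fejer_hat_mass \<delta>)\<^sup>2"
proof -
  have int: "integrable lborel (\<lambda>x. fejer_hat \<delta> (x - 8 ^ i))"
    using lborel_integrable_real_affine[OF integrable_fejer_hat[OF assms], of 1 "- (8 ^ i)"] by simp
  have val: "(LINT x|lborel. fejer_hat \<delta> (x - 8 ^ i)) = fejer_hat_mass \<delta>"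
    unfolding fejer_hat_mass_def using lborel_integral_real_affine[of 1 "fejer_hat \<delta>" "- (8 ^ i)"] by simp
  show "integrable lborel (bump i \<delta>)"
    unfolding bump_def[abs_def] by (rule integrable_lborel_2_prod[OF int integrable_fejer_hat[OF assms]])
  show "(LINT \<xi>|lborel. bump i \<delta> \<xi>) = (fejer_hat_mass \<delta>)\<^sup>2"
    unfolding bump_def integral_lborel_2_prod[OF int integrable_fejer_hat[OF assms]] val
    by (simp add: fejer_hat_mass_def power2_eq_square)
qed

lemma bump_nonneg: "0 \<le> bump i \<delta> \<xi>"
  by (simp add: bump_def fejer_hat_nonneg)

text \<open>
  On a square of side \<open>16 ^ n\<close>, comparable to the inverse width of the bumps, the wave at a frequency
  \<open>\<xi>\<close> in a bump stays in phase with the one at the centre of the bump.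
\<close>

lemma phase_on_bump:
  fixes x \<xi> :: "real^2"
  assumes "i < n" "t \<in> {0..1}" "x $ 1 \<in> {0..16 ^ n}" "x $ 2 \<in> {0..16 ^ n}"
    and "\<bar>\<xi> $ 1 - 8 ^ i\<bar> \<le> width n" "\<bar>\<xi> $ 2\<bar> \<le> width n"
  shows "cos (phase i (x $ 1) t) - 1 / 8 \<le> cos (2 * pi * (x \<bullet> \<xi> + t * (norm \<xi>)\<^sup>2))"
proof -
  let ?w = "width n" and ?L = "16 ^ n :: real"
  define a where "a = \<xi> $ 1 - 8 ^ i"
  define b where "b = \<xi> $ 2"
  have a: "\<bar>a\<bar> \<le> ?w" and b: "\<bar>b\<bar> \<le> ?w" using assms by (simp_all add: a_def b_def)
  have w: "0 < ?w" "?w \<le> 1" using width_pos[of n] width_le[of n] by linarith+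
  have sq: "(64::real) ^ i = 8 ^ i * 8 ^ i" by (simp flip: power_mult_distrib)
  have e: "2 * pi * (x \<bullet> \<xi> + t * (norm \<xi>)\<^sup>2) - phase i (x $ 1) t
      = 2 * pi * (x $ 1 * a + x $ 2 * b + t * ((2 * 8 ^ i) * a + a * a + b * b))"
    unfolding norm_2 by (simp add: phase_def inner_2 a_def b_def sq power2_eq_square algebra_simps)
  have 1: "\<bar>x $ 1 * a\<bar> \<le> ?L * ?w" "\<bar>x $ 2 * b\<bar> \<le> ?L * ?w"
    unfolding abs_mult using assms a b by (auto intro!: mult_mono)
  have sq_le: "\<bar>c * c\<bar> \<le> 1 * ?w" if "\<bar>c\<bar> \<le> ?w" for c
    unfolding abs_mult using that w by (intro mult_mono) linarith+
  have 2: "\<bar>2 * 8 ^ i * a\<bar> \<le> (2 * 8 ^ i) * ?w" "\<bar>a * a\<bar> \<le> 1 * ?w" "\<bar>b * b\<bar> \<le> 1 * ?w"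
    using a sq_le[OF a] sq_le[OF b] by (auto simp: abs_mult)
  have "2 * 8 ^ i + 2 \<le> 2 * ?L"
  proof -
    have "(8::real) ^ Suc i \<le> 8 ^ n" using assms by (intro power_increasing) auto
    also have "(8::real) ^ n \<le> 16 ^ n" by (intro power_mono) auto
    finally have "8 * 8 ^ i \<le> ?L" by (simp only: power_Suc)
    moreover have "(1::real) \<le> 8 ^ i" by simp
    ultimately show ?thesis by linarith
  qed
  then have 3: "(2 * 8 ^ i + 2) * ?w \<le> (2 * ?L) * ?w" using w by (intro mult_right_mono) auto
  have abs3: "\<bar>p + q + r\<bar> \<le> P + Q + R" if "\<bar>p\<bar> \<le> P" "\<bar>q\<bar> \<le> Q" "\<bar>r\<bar> \<le> R" for p q r P Q R :: real
    using that by linarith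
  have "\<bar>t * ((2 * 8 ^ i) * a + a * a + b * b)\<bar> \<le> 1 * \<bar>(2 * 8 ^ i) * a + a * a + b * b\<bar>"
    unfolding abs_mult using assms by (intro mult_right_mono) auto
  also have "\<dots> \<le> (2 * 8 ^ i) * ?w + 1 * ?w + 1 * ?w"
    using abs3[OF 2] by simp
  also have "\<dots> \<le> (2 * ?L) * ?w" using 3 by (simp add: distrib_right)
  finally have "\<bar>x $ 1 * a + x $ 2 * b + t * ((2 * 8 ^ i) * a + a * a + b * b)\<bar>
      \<le> ?L * ?w + ?L * ?w + (2 * ?L) * ?w"
    by (rule abs3[OF 1])
  also have "\<dots> = 4 * (?L * ?w)" by simp
  also have "4 * (?L * ?w) = 1 / 64" by (simp add: width_def)
  finally have "2 * pi * \<bar>x $ 1 * a + x $ 2 * b + t * ((2 * 8 ^ i) * a + a * a + b * b)\<bar> \<le> 2 * 4 * (1 / 64)"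
    using pi_less_4 by (intro mult_mono) auto
  then have "\<bar>2 * pi * (x \<bullet> \<xi> + t * (norm \<xi>)\<^sup>2) - phase i (x $ 1) t\<bar> \<le> 1 / 8"
    unfolding e abs_mult by simp
  then show ?thesis
    using abs_cos_diff_le[of "2 * pi * (x \<bullet> \<xi> + t * (norm \<xi>)\<^sup>2)" "phase i (x $ 1) t"] by linarith
qed

text \<open>
  Since the bumps are nonnegative, the cosines can be compared pointwise under the integral, and up to an
  error of \<open>1 / 8\<close> per bump the solution has the real part of the periodic one, times the mass of a bump.
\<close>

lemma schroedinger_datum_ge:
  fixes x :: "real^2"
  assumes "t \<in> {0..1}" "x $ 1 \<in> {0..16 ^ n}" "x $ 2 \<in> {0..16 ^ n}"
  shows "(fejer_hat_mass (width n))\<^sup>2 * ((\<Sum>i<n. cos (phase i (x $ 1) t)) - n / 8)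
       \<le> Re (schroedinger_R (datum_ft n (width n)) x t)"
proof -
  let ?b = "\<lambda>i. bump i (width n)" and ?th = "\<lambda>\<xi>. 2 * pi * (x \<bullet> \<xi> + t * (norm \<xi>)\<^sup>2)"
  have int: "integrable lborel (?b i)" for i
    by (rule integrable_bump[OF width_pos])
  have cis [measurable]: "(\<lambda>\<xi>. cis (?th \<xi>)) \<in> borel_measurable borel"
    and cos [measurable]: "(\<lambda>\<xi>. cos (?th \<xi>)) \<in> borel_measurable borel"
    by (intro borel_measurable_continuous_onI continuous_intros)+
  have intc: "integrable lborel (\<lambda>\<xi>. ?b i \<xi> * cos (?th \<xi>))" for i
    by (rule Bochner_Integration.integrable_bound[OF int[of i]])
       (auto simp: abs_mult bump_nonneg mult_left_le)
  have intg: "integrable lborel (\<lambda>\<xi>. datum_ft n (width n) \<xi> * cis (?th \<xi>))"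
    by (rule Bochner_Integration.integrable_bound[of _ "\<lambda>\<xi>. \<Sum>i<n. ?b i \<xi>"])
       (auto simp: norm_mult datum_ft_def simp del: of_real_sum intro!: int)
  have "(fejer_hat_mass (width n))\<^sup>2 * ((\<Sum>i<n. cos (phase i (x $ 1) t)) - n / 8)
      = (\<Sum>i<n. (fejer_hat_mass (width n))\<^sup>2 * (cos (phase i (x $ 1) t) - 1 / 8))"
    by (simp add: sum_subtractf flip: sum_distrib_left)
  also have "\<dots> = (\<Sum>i<n. (LINT \<xi>|lborel. ?b i \<xi> * (cos (phase i (x $ 1) t) - 1 / 8)))"
    by (simp add: integral_bump[OF width_pos])
  also have "\<dots> \<le> (\<Sum>i<n. (LINT \<xi>|lborel. ?b i \<xi> * cos (?th \<xi>)))"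
  proof (intro sum_mono integral_mono intc integrable_mult_left int)
    fix i \<xi> assume i: "i \<in> {..<n}"
    show "?b i \<xi> * (cos (phase i (x $ 1) t) - 1 / 8) \<le> ?b i \<xi> * cos (?th \<xi>)"
    proof (cases "width n \<le> \<bar>\<xi> $ 1 - 8 ^ i\<bar> \<or> width n \<le> \<bar>\<xi> $ 2\<bar>")
      case True
      then show ?thesis by (auto simp: bump_def fejer_hat_eq_0)
    next
      case False
      then show ?thesis using assms i by (intro mult_left_mono phase_on_bump bump_nonneg) auto
    qed
  qed
  also have "\<dots> = (LINT \<xi>|lborel. (\<Sum>i<n. ?b i \<xi> * cos (?th \<xi>)))"
    by (intro Bochner_Integration.integral_sum[symmetric] intc)
  also have "\<dots> = (LINT \<xi>|lborel. Re (datum_ft n (width n) \<xi> * cis (?th \<xi>)))"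
    by (intro Bochner_Integration.integral_cong refl) (simp add: datum_ft_def sum_distrib_right del: of_real_sum)
  also have "\<dots> = Re (schroedinger_R (datum_ft n (width n)) x t)"
    unfolding schroedinger_R_def by (rule integral_Re[OF intg])
  finally show ?thesis .
qed

text \<open>
  The argument on the torus is repeated on a square of side \<open>16 ^ n\<close>. The error \<open>n / 8\<close> in \<open>Re u\<close> costs
  \<open>n\<^sup>2 / 8\<close> out of the gain \<open>n\<^sup>2 / 4\<close>.
\<close>

lemma energy_strip_mass:
  "ennreal ((16 ^ n)\<^sup>2 * fejer_hat_mass (width n) ^ 4 * (real n)\<^sup>2 / 8) \<le> energy_R (datum_ft n (width n)) (strip_weight n)"
proof -
  let ?A = "(fejer_hat_mass (width n))\<^sup>2" and ?u = "schroedinger_R (datum_ft n (width n))"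
  let ?F = "\<lambda>t x. ?A\<^sup>2 * ((real n * (\<Sum>j<n. cos (phase j x t)) - 3 * (real n)\<^sup>2 / 8) * riesz n (\<lambda>i. phase i x t))"
  let ?G = "\<lambda>t x. ennreal ((norm (?u x t))\<^sup>2 * strip_weight n (x, t))"
  let ?E = "(16 ^ n)\<^sup>2 * fejer_hat_mass (width n) ^ 4 * (real n)\<^sup>2 / 8"
  have slice: "ennreal ?E \<le> (\<integral>\<^sup>+x. ?G t x \<partial>lborel)" if t: "t \<in> {0..1}" for t
  proof -
    have "ennreal (real (16 ^ n) * (?A\<^sup>2 * (real (16 ^ n) * ((real n)\<^sup>2 / 2 - 3 * (real n)\<^sup>2 / 8)))) \<le> (\<integral>\<^sup>+x. ?G t x \<partial>lborel)"
    proof (rule nn_integral_square_ge[OF _ has_integral_mult_right[OF riesz_slice_energy[where t = t]]])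
      fix x :: "real^2" assume x: "x $ 1 \<in> {0..real (16 ^ n)}" "x $ 2 \<in> {0..real (16 ^ n)}"
      have "?A * ((\<Sum>i<n. cos (phase i (x $ 1) t)) - n / 8) \<le> Re (?u x t)"
        using x t by (intro schroedinger_datum_ge) auto
      then have "?A * n * (?A * ((\<Sum>i<n. cos (phase i (x $ 1) t)) - n / 8)) \<le> ?A * n * Re (?u x t)"
        by (intro mult_left_mono) auto
      moreover have "?A * n * Re (?u x t) - (?A * n / 2)\<^sup>2 \<le> (norm (?u x t))\<^sup>2"
        using square_minorant[of "?A * n / 2" "?u x t"] by simp
      moreover have "?A * n * (?A * ((\<Sum>i<n. cos (phase i (x $ 1) t)) - n / 8)) - (?A * n / 2)\<^sup>2
          = ?A\<^sup>2 * (real n * (\<Sum>j<n. cos (phase j (x $ 1) t)) - 3 * (real n)\<^sup>2 / 8)"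
        by (simp add: power2_eq_square field_simps)
      ultimately have "?A\<^sup>2 * (real n * (\<Sum>j<n. cos (phase j (x $ 1) t)) - 3 * (real n)\<^sup>2 / 8) \<le> (norm (?u x t))\<^sup>2"
        by linarith
      then have "?F t (x $ 1) \<le> (norm (?u x t))\<^sup>2 * riesz n (\<lambda>i. phase i (x $ 1) t)"
        unfolding mult.assoc[symmetric] by (intro mult_right_mono riesz_nonneg)
      then show "ennreal (?F t (x $ 1)) \<le> ?G t x"
        using t by (simp add: strip_weight_eq ennreal_leI)
    qed (intro continuous_intros)
    moreover have "real (16 ^ n) * (?A\<^sup>2 * (real (16 ^ n) * ((real n)\<^sup>2 / 2 - 3 * (real n)\<^sup>2 / 8))) = ?E"
    proof -
      have "?A\<^sup>2 = fejer_hat_mass (width n) ^ 4" by (simp flip: power_mult)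
      then show ?thesis by (simp add: power2_eq_square[of "16 ^ n :: real"] field_simps)
    qed
    ultimately show ?thesis by (simp only:)
  qed
  have "ennreal ?E = (\<integral>\<^sup>+t\<in>{0..1}. ennreal ?E \<partial>(lborel :: real measure))"
    by (simp add: nn_integral_cmult)
  also have "\<dots> \<le> energy_R (datum_ft n (width n)) (strip_weight n)"
    unfolding energy_R_def using slice by (intro nn_integral_mono) (auto simp: indicator_def)
  finally show ?thesis .
qed

lemma energy_strip:
  "ennreal ((pi * fejer_mass) ^ 4 * (real n)\<^sup>2 * width n ^ 6 / 2 ^ 19) \<le> energy_R (datum_ft n (width n)) (strip_weight n)"
proof -
  let ?w = "width n"
  have "(pi * fejer_mass) ^ 4 * (real n)\<^sup>2 * ?w ^ 6 / 2 ^ 19 = (16 ^ n)\<^sup>2 * (pi * fejer_mass * ?w\<^sup>2) ^ 4 * (real n)\<^sup>2 / 8"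
    by (simp add: width_def power_mult_distrib power_divide field_simps)
  also have "\<dots> \<le> (16 ^ n)\<^sup>2 * fejer_hat_mass ?w ^ 4 * (real n)\<^sup>2 / 8"
    using fejer_hat_mass_ge[OF width_pos, of n] fejer_mass_pos
    by (intro divide_right_mono mult_right_mono mult_left_mono power_mono) auto
  finally show ?thesis using energy_strip_mass[of n] by (meson ennreal_leI order_trans)
qed

lemma euclidean_constants_ge:
  assumes "1 \<le> n" "8 ^ n \<le> N"
  shows "ennreal (n / 2 ^ 26) \<le> S_R TYPE(2) N"
    and "ennreal (fejer_mass ^ 4 / (2 ^ 38 * pi ^ 6) * n) \<le> M_R TYPE(2) N"
proof -
  let ?w = "width n" and ?g = "datum_ft n (width n)" and ?u0 = "datum n (width n)" and ?W = "strip_weight n"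
  let ?e = "(pi * fejer_mass) ^ 4 * (real n)\<^sup>2 * ?w ^ 6 / 2 ^ 19"
  have w: "0 < ?w" "?w \<le> 1" "?w \<le> 1 / 2" using width_pos[of n] width_le[of n] by linarith+
  have n: "0 < real n" using assms by simp
  have double: "ennreal x * 2 = ennreal (2 * x)" for x
    using ennreal_mult'[of 2 x] by (simp add: mult.commute)
  note hyps = weight_strip_weight fourier_L2_datum[OF w(1,3)]
    order_trans[OF ess_support_datum_ft tubes_subset_box[OF assms(2)]]
  show "ennreal (n / 2 ^ 26) \<le> S_R TYPE(2) N"
    unfolding S_R_def
  proof (rule Inf_greatest, clarify)
    fix C assume "\<forall>w u0 g. weight w \<longrightarrow> fourier_L2 u0 g \<longrightarrow> ess_support g \<subseteq> box_R N \<longrightarrow>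
       energy_R g w \<le> C * (\<integral>\<^sup>+v. ennreal ((norm (g v))\<^sup>2) * (SUP x :: real^2. xray_R w x v) \<partial>lborel)"
    with hyps have "energy_R ?g ?W \<le> C * (\<integral>\<^sup>+v. ennreal ((norm (?g v))\<^sup>2) * (SUP x. xray_R ?W x v) \<partial>lborel)"
      by blast
    also have "\<dots> \<le> C * (\<integral>\<^sup>+v. ennreal ((norm (?g v))\<^sup>2) * 2 \<partial>lborel)"
    proof (rule mult_left_mono, rule nn_integral_mono)
      fix v
      show "ennreal ((norm (?g v))\<^sup>2) * (SUP x. xray_R ?W x v) \<le> ennreal ((norm (?g v))\<^sup>2) * 2"
        by (cases "v \<in> tubes n") (auto intro!: mult_left_mono SUP_least xray_strip_le simp: datum_ft_eq_0)
    qed simp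
    also have "\<dots> = C * (L2_norm_sq UNIV ?g * 2)"
      by (simp add: nn_integral_multc L2_norm_sq_def)
    also have "\<dots> \<le> C * (ennreal (4 * real n * (2 * pi * fejer_mass) ^ 4 * ?w ^ 6) * 2)"
      by (intro mult_left_mono mult_right_mono L2_norm_datum_ft w) auto
    also have "\<dots> = C * ennreal (2 * (4 * real n * (2 * pi * fejer_mass) ^ 4 * ?w ^ 6))"
      unfolding double ..
    finally have "ennreal ?e \<le> C * ennreal (2 * (4 * real n * (2 * pi * fejer_mass) ^ 4 * ?w ^ 6))"
      by (rule order_trans[OF energy_strip])
    from ennreal_divide_le_admissible[OF this]
    have "ennreal (?e / (2 * (4 * real n * (2 * pi * fejer_mass) ^ 4 * ?w ^ 6))) \<le> C"
      using n w fejer_mass_pos by simp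
    also have "?e / (2 * (4 * real n * (2 * pi * fejer_mass) ^ 4 * ?w ^ 6)) = n / 2 ^ 26"
      using n w fejer_mass_pos by (simp add: power_mult_distrib power2_eq_square)
    finally show "ennreal (n / 2 ^ 26) \<le> C" .
  qed
  show "ennreal (fejer_mass ^ 4 / (2 ^ 38 * pi ^ 6) * n) \<le> M_R TYPE(2) N"
    unfolding M_R_def
  proof (rule Inf_greatest, clarify)
    fix C assume "\<forall>w u0 g. weight w \<longrightarrow> fourier_L2 u0 g \<longrightarrow> ess_support g \<subseteq> box_R N \<longrightarrow>
       energy_R g w \<le> C * (SUP (x :: real^2, v) \<in> UNIV \<times> ess_support g. xray_R w x v) * L2_norm_sq UNIV u0"
    with hyps have "energy_R ?g ?W \<le> C * (SUP (x, v) \<in> UNIV \<times> ess_support ?g. xray_R ?W x v) * L2_norm_sq UNIV ?u0"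
      by blast
    also have "\<dots> \<le> C * 2 * ennreal (3 * 256\<^sup>2 * pi ^ 10 * n * ?w ^ 6)"
      using ess_support_datum_ft
      by (intro mult_mono SUP_least L2_norm_datum w) (auto intro!: xray_strip_le)
    also have "\<dots> \<le> C * 2 * ennreal (2 ^ 18 * pi ^ 10 * n * ?w ^ 6)"
      using n w by (intro mult_left_mono ennreal_leI mult_right_mono) auto
    also have "\<dots> = C * ennreal (2 * (2 ^ 18 * pi ^ 10 * n * ?w ^ 6))"
      unfolding double[symmetric] by (simp add: mult_ac)
    finally have "ennreal ?e \<le> C * ennreal (2 * (2 ^ 18 * pi ^ 10 * n * ?w ^ 6))"
      by (rule order_trans[OF energy_strip])
    from ennreal_divide_le_admissible[OF this]
    have "ennreal (?e / (2 * (2 ^ 18 * pi ^ 10 * n * ?w ^ 6))) \<le> C"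
      using n w by simp
    also have "?e / (2 * (2 ^ 18 * pi ^ 10 * n * ?w ^ 6)) = fejer_mass ^ 4 / (2 ^ 38 * pi ^ 6) * n"
    proof -
      have "(p * f * (real n)\<^sup>2 * r) / 2 ^ 19 / (2 * (2 ^ 18 * (p * q) * n * r)) = f / (2 ^ 38 * q) * n"
        if "0 < p" "0 < r" for p q r f :: real
        using n that by (simp add: power2_eq_square)
      from this[of "pi ^ 4" "?w ^ 6" "fejer_mass ^ 4" "pi ^ 6"] show ?thesis
        using w by (simp add: power_mult_distrib flip: power_add)
    qed
    finally show "ennreal (fejer_mass ^ 4 / (2 ^ 38 * pi ^ 6) * n) \<le> C" .
  qed
qed

section \<open>Conclusion\<close>

theorem mainTheorem6:
  "\<exists>c::real. 0 < c \<and>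
     (\<forall>\<^sub>F N::real in at_top.
        ennreal (ln N powr (c / ln (ln (ln N)))) \<le> S_T TYPE(2) N \<and>
        ennreal (ln N powr (c / ln (ln (ln N)))) \<le> M_T TYPE(2) N \<and>
        ennreal (ln N powr (c / ln (ln (ln N)))) \<le> S_R TYPE(2) N \<and>
        ennreal (ln N powr (c / ln (ln (ln N)))) \<le> M_R TYPE(2) N)"
proof (intro exI[of _ 1] conjI)
  define c0 :: real where "c0 = min (1 / 2 ^ 26) (fejer_mass ^ 4 / (2 ^ 38 * pi ^ 6))"
  have c0: "0 < c0" "c0 \<le> 1 / 2 ^ 26" "c0 \<le> fejer_mass ^ 4 / (2 ^ 38 * pi ^ 6)"
    using fejer_mass_pos by (auto simp: c0_def)
  \<comment> \<open>From the three thresholds: \<open>ln N / ln 8 - 1 \<ge> ln N / 8\<close>, then \<open>sqrt (ln N) \<le> c0 * (ln N / 8)\<close>, and finally \<open>ln (ln (ln N)) \<ge> 2\<close>.\<close>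
  define X where "X = max 56 (max (64 / c0\<^sup>2) (exp (exp 2)))"
  have "\<forall>\<^sub>F N::real in at_top. exp X \<le> N" by (rule eventually_ge_at_top)
  then show "\<forall>\<^sub>F N::real in at_top.
        ennreal (ln N powr (1 / ln (ln (ln N)))) \<le> S_T TYPE(2) N \<and>
        ennreal (ln N powr (1 / ln (ln (ln N)))) \<le> M_T TYPE(2) N \<and>
        ennreal (ln N powr (1 / ln (ln (ln N)))) \<le> S_R TYPE(2) N \<and>
        ennreal (ln N powr (1 / ln (ln (ln N)))) \<le> M_R TYPE(2) N"
  proof eventually_elim
    case (elim N)
    have N: "0 < N" using less_le_trans[OF exp_gt_zero elim] .
    have "X \<le> ln N" using elim N by (simp add: ln_ge_iff)
    then have x: "56 \<le> ln N" "64 / c0\<^sup>2 \<le> ln N" "exp (exp 2) \<le> ln N" by (auto simp: X_def)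
    have ln8: "0 < ln (8::real)" "ln (8::real) \<le> 7" using ln_le_minus_one[of "8::real"] by auto
    have "exp 2 \<le> ln (ln N)" using x by (subst ln_ge_iff) auto
    then have "2 \<le> ln (ln (ln N))"
      using less_le_trans[OF exp_gt_zero] by (subst ln_ge_iff) auto
    then have "1 / ln (ln (ln N)) \<le> 1 / 2" by (intro frac_le) auto
    then have "ln N powr (1 / ln (ln (ln N))) \<le> ln N powr (1 / 2)"
      using x by (intro powr_mono) auto
    also have "\<dots> = sqrt (ln N)" using x by (simp add: powr_half_sqrt)
    also have "\<dots> \<le> c0 * (ln N / 8)"
    proof -
      have "8 / c0 = sqrt (64 / c0\<^sup>2)" using c0 by (simp add: real_sqrt_divide)
      also have "\<dots> \<le> sqrt (ln N)" using x by simp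
      finally have "8 \<le> c0 * sqrt (ln N)" using c0 by (simp add: field_simps)
      then have "8 * sqrt (ln N) \<le> (c0 * sqrt (ln N)) * sqrt (ln N)"
        using x by (intro mult_right_mono) auto
      then show ?thesis using x by (simp add: mult.assoc)
    qed
    also have "\<dots> \<le> c0 * (ln N / ln 8 - 1)"
    proof -
      have "ln N / 7 \<le> ln N / ln 8" using x ln8 by (intro divide_left_mono) auto
      then show ?thesis using x c0 by (intro mult_left_mono) auto
    qed
    finally have bound: "ln N powr (1 / ln (ln (ln N))) \<le> c0 * (ln N / ln 8 - 1)" .
    define n where "n = nat \<lfloor>ln N / ln 8\<rfloor>"
    have q: "1 \<le> ln N / ln 8" using x ln8 by (simp add: field_simps)
    then have "1 \<le> \<lfloor>ln N / ln 8\<rfloor>" by (simp only: le_floor_iff of_int_1)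
    then have n1: "1 \<le> n" unfolding n_def by linarith
    have nle: "real n \<le> ln N / ln 8" and nge: "ln N / ln 8 - 1 \<le> real n"
      using q unfolding n_def by linarith+
    have "ln (8 ^ n) \<le> ln N" using nle ln8 by (simp add: ln_realpow field_simps)
    then have nN: "8 ^ n \<le> N" using N by (subst (asm) ln_le_cancel_iff) auto
    have "c0 * (ln N / ln 8 - 1) \<le> c0 * n" using c0 nge by (intro mult_left_mono) auto
    with bound have main: "ln N powr (1 / ln (ln (ln N))) \<le> c0 * n" by (rule order_trans)
    have le: "ennreal (ln N powr (1 / ln (ln (ln N)))) \<le> ennreal (b * n)" if "c0 \<le> b" for b
      using main mult_right_mono[OF that, of "real n"] by (intro ennreal_leI) auto
    have T: "ennreal (ln N powr (1 / ln (ln (ln N)))) \<le> ennreal (real n / 4)"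
      and S: "ennreal (ln N powr (1 / ln (ln (ln N)))) \<le> ennreal (n / 2 ^ 26)"
      and M: "ennreal (ln N powr (1 / ln (ln (ln N)))) \<le> ennreal (fejer_mass ^ 4 / (2 ^ 38 * pi ^ 6) * n)"
      using le[of "1 / 4"] le[of "1 / 2 ^ 26"] le[OF c0(3)] c0 by simp_all
    show ?case
      using order_trans[OF T torus_constants_ge(1)[OF n1 nN]] order_trans[OF T torus_constants_ge(2)[OF n1 nN]]
        order_trans[OF S euclidean_constants_ge(1)[OF n1 nN]] order_trans[OF M euclidean_constants_ge(2)[OF n1 nN]]
      by blast
  qed
qed simp

end
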